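(* Fix an integer $d\ge2$. Consider the directed game on the infinite $d$-ary tree with i.i.d. payoffs supported on the interval $[0,1]$. Then there exists a real number $v_\infty\in[0,1]$ such that, for every $\delta\in(0,1/2)$, there exists $K>0$ such that, for every $n\ge1$ and $t\ge0$, $$\mathbb{P}\left(|V_n-v_\infty|\ge t+2t^2+Kn^{-\delta}\right)\le\exp\left(-\frac16\exp\left(\frac{t^2n}{4}\right)\right).$$ Consequently, $(V_n)_{n\ge1}$ converges almost surely to $v_\infty$.
   Context: The infinite $d$-ary tree is the infinite rooted tree in which every vertex has exactly $d$ children, with every edge oriented from the parent to the child; its vertex set is $Z$. Each vertex $z\in Z$ carries a payoff $G_z$, the $(G_z)_{z\in Z}$ being i.i.d. real random variables, sampled first and known to both players. A token starts at a fixed, arbitrary initial vertex $z_0$; for each integer $i\ge0$, at stage $i+1$, the token being at $z$, Player 1 (if $i$ is even) or Player 2 (if $i$ is odd) moves it to a child $z'$ of $z$, and Player 1 receives $G_{z'}$ from Player 2. A strategy of Player 1 (resp. Player 2) is a function $\sigma:\bigcup_{m\ge0}Z^{2m+1}\to Z$ (resp. $\tau:\bigcup_{m\ge0}Z^{2m+2}\to Z$) such that $\sigma(z_0,\dots,z_{2m})$ is always a child of $z_{2m}$ (resp. $\tau(z_0,\dots,z_{2m+1})$ is always a child of $z_{2m+1}$). $\Sigma$ and $\mathcal{T}$ denote the sets of strategies of Players 1 and 2. A pair $(\sigma,\tau)$ determines the trajectory $z_{2i+1}=\sigma(z_0,\dots,z_{2i})$, $z_{2i+2}=\tau(z_0,\dots,z_{2i+1})$,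 $i\ge0$. The $n$-stage payoff is $\gamma_n^{z_0}(\sigma,\tau)=\frac1n\sum_{i=1}^nG_{z_i}$, and the $n$-value (a random variable) is $$V_n=V_n(z_0)=\max_{\sigma\in\Sigma}\min_{\tau\in\mathcal{T}}\gamma_n^{z_0}(\sigma,\tau)=\min_{\tau\in\mathcal{T}}\max_{\sigma\in\Sigma}\gamma_n^{z_0}(\sigma,\tau).$$ The distribution of $V_n(z_0)$ does not depend on $z_0$. *)

theory Defs
  imports "HOL-Probability.Probability"
begin

text \<open>
  The infinite \<open>d\<close>-ary tree: a vertex is the word over \<open>{..<d}\<close> that labels the path leading to
  it from the root \<open>[]\<close>, and edges go from \<open>z\<close> to \<open>z @ [i]\<close>.
\<close>

definition dtree :: "nat \<Rightarrow> nat list set" where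
  "dtree d = lists {..<d}"

definition children :: "nat \<Rightarrow> nat list \<Rightarrow> nat list set" where
  "children d z = (\<lambda>i. z @ [i]) ` {..<d}"

text \<open>
  A tuple \<open>(z\<^sub>0, \<dots>, z\<^sub>k)\<close> of vertices is the list \<open>[z\<^sub>0, \<dots>, z\<^sub>k]\<close>, so Player 1 moves at tuples of odd
  length and Player 2 at nonempty tuples of even length. As for strategies in the literature,
  arbitrary tuples of vertices are allowed as arguments, not only paths of the tree.
\<close>

definition tuples1 :: "nat \<Rightarrow> nat list list set" where
  "tuples1 d = {h \<in> lists (dtree d). \<exists>m. length h = 2 * m + 1}"

definition tuples2 :: "nat \<Rightarrow> nat list list set" where
  "tuples2 d = {h \<in> lists (dtree d). \<exists>m. length h = 2 * m + 2}"

definition strategies1 :: "nat \<Rightarrow> (nat list list \<Rightarrow> nat list) set" where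
  "strategies1 d = (\<Pi>\<^sub>E h\<in>tuples1 d. children d (last h))"

definition strategies2 :: "nat \<Rightarrow> (nat list list \<Rightarrow> nat list) set" where
  "strategies2 d = (\<Pi>\<^sub>E h\<in>tuples2 d. children d (last h))"

text \<open>\<open>play \<sigma> \<tau> z\<^sub>0 k\<close> is the list \<open>[z\<^sub>0, \<dots>, z\<^sub>k]\<close> of the first \<open>k + 1\<close> positions of the token.\<close>

primrec play ::
    "(nat list list \<Rightarrow> nat list) \<Rightarrow> (nat list list \<Rightarrow> nat list) \<Rightarrow> nat list \<Rightarrow> nat \<Rightarrow> nat list list" where
  "play \<sigma> \<tau> z0 0 = [z0]"
| "play \<sigma> \<tau> z0 (Suc k) = play \<sigma> \<tau> z0 k @ [(if even k then \<sigma> else \<tau>) (play \<sigma> \<tau> z0 k)]"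

definition trajectory ::
    "(nat list list \<Rightarrow> nat list) \<Rightarrow> (nat list list \<Rightarrow> nat list) \<Rightarrow> nat list \<Rightarrow> nat \<Rightarrow> nat list" where
  "trajectory \<sigma> \<tau> z0 k = last (play \<sigma> \<tau> z0 k)"

text \<open>In the following, \<open>g z\<close> is the realized payoff at the vertex \<open>z\<close>.\<close>

definition stage_payoff ::
    "(nat list \<Rightarrow> real) \<Rightarrow> nat list \<Rightarrow> nat \<Rightarrow>
      (nat list list \<Rightarrow> nat list) \<Rightarrow> (nat list list \<Rightarrow> nat list) \<Rightarrow> real" where
  "stage_payoff g z0 n \<sigma> \<tau> = (1 / real n) * (\<Sum>i=1..n. g (trajectory \<sigma> \<tau> z0 i))"

definition game_value :: "nat \<Rightarrow> (nat list \<Rightarrow> real) \<Rightarrow> nat list \<Rightarrow> nat \<Rightarrow> real" where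
  "game_value d g z0 n =
    (MAX \<sigma>\<in>strategies1 d. MIN \<tau>\<in>strategies2 d. stage_payoff g z0 n \<sigma> \<tau>)"

text \<open>
  The strategy sets are infinite, but \<open>play\<close> takes finitely many values for each \<open>n\<close>. Hence the
  maximum and the minimum above are those of finite nonempty sets, the order in which they are
  taken does not matter, and the value of the game with random payoffs is a random variable.
\<close>

lemma finite_children: "finite (children d z)"
  by (simp add: children_def)

lemma children_nonempty: "d \<ge> 1 \<Longrightarrow> children d z \<noteq> {}"
  by (auto simp: children_def lessThan_empty_iff)

lemma children_subset: "z \<in> dtree d \<Longrightarrow> children d z \<subseteq> dtree d"
  by (auto simp: children_def dtree_def)

lemma length_play [simp]: "length (play \<sigma> \<tau> z0 k) = Suc k"
  by (induction k) auto

lemma play_nonempty [simp]: "play \<sigma> \<tau> z0 k \<noteq> []"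
  by (metis length_play list.size(3) nat.distinct(1))

lemma play_step:
  assumes "\<sigma> \<in> strategies1 d" "\<tau> \<in> strategies2 d" "play \<sigma> \<tau> z0 k \<in> lists (dtree d)"
  shows "(if even k then \<sigma> else \<tau>) (play \<sigma> \<tau> z0 k) \<in> children d (last (play \<sigma> \<tau> z0 k))"
proof (cases "even k")
  case True
  then have "play \<sigma> \<tau> z0 k \<in> tuples1 d"
    using assms(3) by (auto simp: tuples1_def elim: evenE)
  then show ?thesis using assms(1) True by (auto simp: strategies1_def PiE_iff)
next
  case False
  then have "play \<sigma> \<tau> z0 k \<in> tuples2 d"
    using assms(3) by (auto simp: tuples2_def elim: oddE)
  then show ?thesis using assms(2) False by (auto simp: strategies2_def PiE_iff)
qed

lemma play_in_tree:
  assumes "\<sigma> \<in> strategies1 d" "\<tau> \<in> strategies2 d" "z0 \<in> dtree d"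
  shows "play \<sigma> \<tau> z0 k \<in> lists (dtree d)"
proof (induction k)
  case (Suc k)
  have "last (play \<sigma> \<tau> z0 k) \<in> dtree d"
    using in_listsD[OF Suc] last_in_set[OF play_nonempty] by (rule bspec)
  then have "(if even k then \<sigma> else \<tau>) (play \<sigma> \<tau> z0 k) \<in> dtree d"
    by (rule children_subset[THEN subsetD]) (rule play_step[OF assms(1,2) Suc])
  then show ?case
    using Suc by simp
qed (use assms in auto)

lemma nth_play: "i \<le> n \<Longrightarrow> play \<sigma> \<tau> z0 n ! i = trajectory \<sigma> \<tau> z0 i"
proof (induction n)
  case (Suc n)
  then show ?case
    by (cases "i = Suc n") (auto simp: nth_append trajectory_def)
qed (auto simp: trajectory_def)

lemma stage_payoff_eq:
  "stage_payoff g z0 n \<sigma> \<tau> = (1 / real n) * (\<Sum>i=1..n. g (play \<sigma> \<tau> z0 n ! i))"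
  by (simp add: stage_payoff_def nth_play)

lemma finite_plays:
  assumes "z0 \<in> dtree d"
  shows "finite {play \<sigma> \<tau> z0 n |\<sigma> \<tau>. \<sigma> \<in> strategies1 d \<and> \<tau> \<in> strategies2 d}"
proof (induction n)
  case 0
  show ?case by (rule finite_subset[of _ "{[z0]}"]) auto
next
  case (Suc n)
  let ?S = "{play \<sigma> \<tau> z0 n |\<sigma> \<tau>. \<sigma> \<in> strategies1 d \<and> \<tau> \<in> strategies2 d}"
  have "{play \<sigma> \<tau> z0 (Suc n) |\<sigma> \<tau>. \<sigma> \<in> strategies1 d \<and> \<tau> \<in> strategies2 d}
      \<subseteq> (\<Union>h\<in>?S. (\<lambda>c. h @ [c]) ` children d (last h))"
  proof (rule subsetI)
    fix h assume "h \<in> {play \<sigma> \<tau> z0 (Suc n) |\<sigma> \<tau>. \<sigma> \<in> strategies1 d \<and> \<tau> \<in> strategies2 d}"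
    then obtain \<sigma> \<tau> where st: "\<sigma> \<in> strategies1 d" "\<tau> \<in> strategies2 d"
      and h: "h = play \<sigma> \<tau> z0 (Suc n)"
      by blast
    have "play \<sigma> \<tau> z0 n \<in> ?S" using st by blast
    moreover have "h \<in> (\<lambda>c. play \<sigma> \<tau> z0 n @ [c]) ` children d (last (play \<sigma> \<tau> z0 n))"
      unfolding h play.simps by (rule imageI) (rule play_step[OF st play_in_tree[OF st assms]])
    ultimately show "h \<in> (\<Union>h\<in>?S. (\<lambda>c. h @ [c]) ` children d (last h))" by (rule UN_I)
  qed
  then show ?case
    by (rule finite_subset) (use Suc finite_children in auto)
qed

lemma strategies_nonempty:
  assumes "d \<ge> 1" shows "strategies1 d \<noteq> {}" "strategies2 d \<noteq> {}"
  using children_nonempty[OF assms] by (auto simp: strategies1_def strategies2_def PiE_eq_empty_iff)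

primrec backward_value :: "nat \<Rightarrow> (nat list list \<Rightarrow> real) \<Rightarrow> nat \<Rightarrow> nat list list \<Rightarrow> real" where
  "backward_value d F 0 h = F h"
| "backward_value d F (Suc k) h =
    (if odd (length h) then (MAX c\<in>children d (last h). backward_value d F k (h @ [c]))
     else (MIN c\<in>children d (last h). backward_value d F k (h @ [c])))"

lemma optimal_strategy1:
  assumes "d \<ge> 1" "z0 \<in> dtree d"
  obtains \<sigma> where "\<sigma> \<in> strategies1 d"
    "\<And>\<tau>. \<tau> \<in> strategies2 d \<Longrightarrow> backward_value d F n [z0] \<le> F (play \<sigma> \<tau> z0 n)"
proof -
  let ?B = "backward_value d F"
  define good where "good h c \<longleftrightarrow> c \<in> children d (last h) \<and>
    ?B (n - length h) (h @ [c]) = (MAX c\<in>children d (last h). ?B (n - length h) (h @ [c]))" for h c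
  have ex: "\<exists>c. good h c" for h
  proof -
    have "(MAX c\<in>children d (last h). ?B (n - length h) (h @ [c]))
        \<in> (\<lambda>c. ?B (n - length h) (h @ [c])) ` children d (last h)"
      by (intro Max_in) (use assms children_nonempty finite_children in auto)
    then show ?thesis by (auto simp: good_def)
  qed
  define \<sigma> where "\<sigma> = (\<lambda>h\<in>tuples1 d. SOME c. good h c)"
  have good: "good h (\<sigma> h)" if "h \<in> tuples1 d" for h
    using someI_ex[OF ex, of h] that by (simp add: \<sigma>_def)
  have s: "\<sigma> \<in> strategies1 d"
    using good unfolding strategies1_def
    by (intro PiE_I) (auto simp: good_def \<sigma>_def)
  have "k \<le> n \<Longrightarrow> ?B n [z0] \<le> ?B (n - k) (play \<sigma> \<tau> z0 k)" if t: "\<tau> \<in> strategies2 d" for \<tau> k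
  proof (induction k)
    case (Suc k)
    let ?h = "play \<sigma> \<tau> z0 k"
    have n: "n - k = Suc (n - Suc k)" using Suc.prems by simp
    have h: "?h \<in> lists (dtree d)" by (rule play_in_tree[OF s t assms(2)])
    note step = play_step[OF s t h]
    have "?B (n - k) ?h \<le> ?B (n - Suc k) (play \<sigma> \<tau> z0 (Suc k))"
    proof (cases "even k")
      case True
      then have "?h \<in> tuples1 d" using h by (auto simp: tuples1_def elim: evenE)
      from good[OF this] show ?thesis using True unfolding n by (simp add: good_def)
    next
      case False
      then show ?thesis using step unfolding n
        by (auto intro!: Min_le simp: finite_children)
    qed
    then show ?case using Suc by simp
  qed simp
  from this[of _ n] show ?thesis using that[OF s] by simp
qed

lemma optimal_strategy2:
  assumes "d \<ge> 1" "z0 \<in> dtree d"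
  obtains \<tau> where "\<tau> \<in> strategies2 d"
    "\<And>\<sigma>. \<sigma> \<in> strategies1 d \<Longrightarrow> F (play \<sigma> \<tau> z0 n) \<le> backward_value d F n [z0]"
proof -
  let ?B = "backward_value d F"
  define good where "good h c \<longleftrightarrow> c \<in> children d (last h) \<and>
    ?B (n - length h) (h @ [c]) = (MIN c\<in>children d (last h). ?B (n - length h) (h @ [c]))" for h c
  have ex: "\<exists>c. good h c" for h
  proof -
    have "(MIN c\<in>children d (last h). ?B (n - length h) (h @ [c]))
        \<in> (\<lambda>c. ?B (n - length h) (h @ [c])) ` children d (last h)"
      by (intro Min_in) (use assms children_nonempty finite_children in auto)
    then show ?thesis by (auto simp: good_def)
  qed
  define \<tau> where "\<tau> = (\<lambda>h\<in>tuples2 d. SOME c. good h c)"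
  have good: "good h (\<tau> h)" if "h \<in> tuples2 d" for h
    using someI_ex[OF ex, of h] that by (simp add: \<tau>_def)
  have t: "\<tau> \<in> strategies2 d"
    using good unfolding strategies2_def
    by (intro PiE_I) (auto simp: good_def \<tau>_def)
  have "k \<le> n \<Longrightarrow> ?B (n - k) (play \<sigma> \<tau> z0 k) \<le> ?B n [z0]" if s: "\<sigma> \<in> strategies1 d" for \<sigma> k
  proof (induction k)
    case (Suc k)
    let ?h = "play \<sigma> \<tau> z0 k"
    have n: "n - k = Suc (n - Suc k)" using Suc.prems by simp
    have h: "?h \<in> lists (dtree d)" by (rule play_in_tree[OF s t assms(2)])
    note step = play_step[OF s t h]
    have "?B (n - Suc k) (play \<sigma> \<tau> z0 (Suc k)) \<le> ?B (n - k) ?h"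
    proof (cases "even k")
      case False
      then have "?h \<in> tuples2 d" using h by (auto simp: tuples2_def elim: oddE)
      from good[OF this] show ?thesis using False unfolding n by (simp add: good_def)
    next
      case True
      then show ?thesis using step unfolding n
        by (auto intro!: Max_ge simp: finite_children)
    qed
    then show ?case using Suc by simp
  qed simp
  from this[of _ n] show ?thesis using that[OF t] by simp
qed

lemma finite_stage_payoffs:
  assumes "z0 \<in> dtree d"
  shows "finite {stage_payoff g z0 n \<sigma> \<tau> |\<sigma> \<tau>. \<sigma> \<in> strategies1 d \<and> \<tau> \<in> strategies2 d}"
  by (rule finite_subset[OF _ finite_imageI[OF finite_plays[OF assms, of n],
        of "\<lambda>h. (1 / real n) * (\<Sum>i=1..n. g (h ! i))"]])
    (auto simp: stage_payoff_eq)

lemma finite_best_replies: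
  assumes "z0 \<in> dtree d"
  shows "finite ((\<lambda>\<sigma>. (\<lambda>\<tau>. play \<sigma> \<tau> z0 n) ` strategies2 d) ` strategies1 d)"
    and "finite ((\<lambda>\<tau>. (\<lambda>\<sigma>. play \<sigma> \<tau> z0 n) ` strategies1 d) ` strategies2 d)"
  by (rule finite_subset[OF _ finite_Pow_iff[THEN iffD2, OF finite_plays[OF assms, of n]]], auto)+

lemma game_value_eq:
  fixes g :: "nat list \<Rightarrow> real" and n :: nat
  assumes "d \<ge> 1" "z0 \<in> dtree d"
  defines "w \<equiv> backward_value d (\<lambda>h. (1 / real n) * (\<Sum>i=1..n. g (h ! i))) n [z0]"
  shows "game_value d g z0 n = w"
    and "(MIN \<tau>\<in>strategies2 d. MAX \<sigma>\<in>strategies1 d. stage_payoff g z0 n \<sigma> \<tau>) = w"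
proof -
  define F where "F h = (1 / real n) * (\<Sum>i=1..n. g (h ! i))" for h
  have p: "stage_payoff g z0 n \<sigma> \<tau> = F (play \<sigma> \<tau> z0 n)" for \<sigma> \<tau>
    by (simp add: stage_payoff_eq F_def)
  have w: "w = backward_value d F n [z0]" by (simp add: w_def F_def[abs_def])
  obtain \<sigma>' where s: "\<sigma>' \<in> strategies1 d"
    "\<And>\<tau>. \<tau> \<in> strategies2 d \<Longrightarrow> w \<le> F (play \<sigma>' \<tau> z0 n)"
    using optimal_strategy1[OF assms(1,2)] unfolding w by blast
  obtain \<tau>' where t: "\<tau>' \<in> strategies2 d"
    "\<And>\<sigma>. \<sigma> \<in> strategies1 d \<Longrightarrow> F (play \<sigma> \<tau>' z0 n) \<le> w"
    using optimal_strategy2[OF assms(1,2)] unfolding w by blast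
  note fin = finite_stage_payoffs[OF assms(2), of g n, unfolded p]
  have f1: "finite ((\<lambda>\<sigma>. F (play \<sigma> \<tau> z0 n)) ` strategies1 d)" if "\<tau> \<in> strategies2 d" for \<tau>
    by (rule finite_subset[OF _ fin]) (use that in auto)
  have f2: "finite ((\<lambda>\<tau>. F (play \<sigma> \<tau> z0 n)) ` strategies2 d)" if "\<sigma> \<in> strategies1 d" for \<sigma>
    by (rule finite_subset[OF _ fin]) (use that in auto)
  have f3: "finite ((\<lambda>\<sigma>. MIN \<tau>\<in>strategies2 d. F (play \<sigma> \<tau> z0 n)) ` strategies1 d)"
    using finite_imageI[OF finite_best_replies(1)[OF assms(2), of n], of "\<lambda>A. Min (F ` A)"]
    by (simp add: image_image)
  have f4: "finite ((\<lambda>\<tau>. MAX \<sigma>\<in>strategies1 d. F (play \<sigma> \<tau> z0 n)) ` strategies2 d)"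
    using finite_imageI[OF finite_best_replies(2)[OF assms(2), of n], of "\<lambda>A. Max (F ` A)"]
    by (simp add: image_image)
  note ne = strategies_nonempty[OF assms(1)]
  have u: "(MIN \<tau>\<in>strategies2 d. F (play \<sigma> \<tau> z0 n)) \<le> w" if "\<sigma> \<in> strategies1 d" for \<sigma>
    using that t ne f2 by (subst Min_le_iff) auto
  have l: "w \<le> (MAX \<sigma>\<in>strategies1 d. F (play \<sigma> \<tau> z0 n))" if "\<tau> \<in> strategies2 d" for \<tau>
    using that s ne f1 by (subst Max_ge_iff) auto
  have "w \<le> (MIN \<tau>\<in>strategies2 d. F (play \<sigma>' \<tau> z0 n))"
    using s f2[OF s(1)] ne by (subst Min_ge_iff) auto
  then show "game_value d g z0 n = w"
    unfolding game_value_def p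
    by (intro antisym) (use u s(1) f3 ne in \<open>auto simp: Max_ge_iff\<close>)
  have "(MAX \<sigma>\<in>strategies1 d. F (play \<sigma> \<tau>' z0 n)) \<le> w"
    using t f1[OF t(1)] ne by (subst Max_le_iff) auto
  then show "(MIN \<tau>\<in>strategies2 d. MAX \<sigma>\<in>strategies1 d. stage_payoff g z0 n \<sigma> \<tau>) = w"
    unfolding p
    by (intro antisym) (use l t(1) f4 ne in \<open>auto simp: Min_le_iff\<close>)
qed

lemma game_value_minimax:
  assumes "d \<ge> 1" "z0 \<in> dtree d"
  shows "game_value d g z0 n =
    (MIN \<tau>\<in>strategies2 d. MAX \<sigma>\<in>strategies1 d. stage_payoff g z0 n \<sigma> \<tau>)"
  using game_value_eq[OF assms] by simp

lemma borel_measurable_game_value: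
  assumes "z0 \<in> dtree d" and G: "\<And>z. z \<in> dtree d \<Longrightarrow> G z \<in> borel_measurable M"
  shows "(\<lambda>\<omega>. game_value d (\<lambda>z. G z \<omega>) z0 n) \<in> borel_measurable M"
proof -
  define F where "F h \<omega> = (1 / real n) * (\<Sum>i=1..n. G (h ! i) \<omega>)" for h \<omega>
  define C where "C = (\<lambda>\<sigma>. (\<lambda>\<tau>. play \<sigma> \<tau> z0 n) ` strategies2 d) ` strategies1 d"
  have eq: "game_value d (\<lambda>z. G z \<omega>) z0 n = (MAX A\<in>C. MIN h\<in>A. F h \<omega>)" for \<omega>
    by (simp add: game_value_def stage_payoff_eq C_def image_image F_def)
  have F: "F h \<in> borel_measurable M" if "A \<in> C" "h \<in> A" for A h
  proof -
    obtain \<sigma> \<tau> where st: "\<sigma> \<in> strategies1 d" "\<tau> \<in> strategies2 d" "h = play \<sigma> \<tau> z0 n"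
      using \<open>A \<in> C\<close> \<open>h \<in> A\<close> unfolding C_def by auto
    from play_in_tree[OF st(1,2) assms(1), of n]
    have "h ! i \<in> dtree d" if "i \<in> {1..n}" for i
      using that st(3) by (metis atLeastAtMost_iff in_listsD length_play less_Suc_eq_le nth_mem)
    then have "G (h ! i) \<in> borel_measurable M" if "i \<in> {1..n}" for i
      using that G by blast
    then show ?thesis
      unfolding F_def[abs_def] by (intro borel_measurable_times borel_measurable_const borel_measurable_sum)
  qed
  have "finite A" if "A \<in> C" for A
    by (rule finite_subset[OF _ finite_plays[OF assms(1), of n]]) (use that in \<open>auto simp: C_def\<close>)
  then show ?thesis
    unfolding eq
    by (intro borel_measurable_Max borel_measurable_Min F)
       (auto simp: C_def finite_best_replies[OF assms(1)])
qed

end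

theory Submission
  imports Defs
begin

text \<open>
  Let \<open>val n z\<close> be the unnormalized \<open>n\<close>-stage value at \<open>z\<close> and \<open>mean n\<close> its mean. Changing the payoffs of one
  level of the tree moves \<open>val n z\<close> by at most \<open>1\<close>, so its variance is at most \<open>n\<close> and Chebyshev's
  inequality gives concentration at scale \<open>sqrt n\<close> up to a small constant probability. Wasting two
  stages lets a player choose among \<open>d\<close> independent subtrees, which turns a failure probability \<open>p\<close>
  into at most \<open>(d p)\<^sup>2\<close>; wasting \<open>2 k\<close> stages thus makes it doubly exponentially small in \<open>k\<close>. With
  \<open>k\<close> of order at most \<open>sqrt n\<close> this beats the union bound over the \<open>d ^ n\<close> vertices of level \<open>n\<close>, hence
  \<open>mean (n + m) = mean n + mean m + O (sqrt (n + m))\<close> and \<open>mean n = v n + O (sqrt n)\<close>. Taking \<open>2 k\<close> close to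
  \<open>t\<^sup>2 n\<close> yields the tail bound, even with \<open>n powr (-1/2)\<close> in place of \<open>n powr (-\<delta>)\<close>, and the
  Borel--Cantelli lemma yields the almost sure convergence.
\<close>

subsection \<open>Deterministic games on the tree\<close>

text \<open>One flagged operation for maximum and minimum lets every induction over the stages treat
  the moves of both players at once.\<close>

definition optimum :: "bool \<Rightarrow> real set \<Rightarrow> real" where
  "optimum b A = (if b then Max A else Min A)"

text \<open>
  The flag \<open>b\<close> says whether Player 1 moves first, and \<open>u\<close> is a terminal payoff on the last level reached.
\<close>

primrec tree_value ::
    "nat \<Rightarrow> (nat list \<Rightarrow> real) \<Rightarrow> (nat list \<Rightarrow> real) \<Rightarrow> bool \<Rightarrow> nat \<Rightarrow> nat list \<Rightarrow> real" where
  "tree_value d g u b 0 z = u z"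
| "tree_value d g u b (Suc n) z = optimum b ((\<lambda>c. g c + tree_value d g u (\<not> b) n c) ` children d z)"

text \<open>The vertex \<open>z\<close> belongs to it, since with no stage left the value reads the
  terminal payoff at \<open>z\<close>.\<close>

definition subtree :: "nat \<Rightarrow> nat list \<Rightarrow> nat list set" where
  "subtree d z = (\<lambda>w. z @ w) ` dtree d"

lemma self_in_subtree [simp]: "z \<in> subtree d z"
  by (auto simp: subtree_def dtree_def intro!: image_eqI[of _ _ "[]"])

lemma subtree_mono: "w \<in> subtree d z \<Longrightarrow> subtree d w \<subseteq> subtree d z"
  by (auto simp: subtree_def dtree_def intro!: imageI)

lemma children_subtree: "children d z \<subseteq> subtree d z"
  by (auto simp: subtree_def children_def dtree_def)

lemma subtree_dtree: "z \<in> dtree d \<Longrightarrow> subtree d z \<subseteq> dtree d"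
  by (auto simp: subtree_def dtree_def)

lemma length_children: "c \<in> children d z \<Longrightarrow> length c = Suc (length z)"
  by (auto simp: children_def)

lemma optimum_cong:
  "(\<And>c. c \<in> C \<Longrightarrow> f c = f' c) \<Longrightarrow> optimum b (f ` C) = optimum b (f' ` C)"
  by (simp add: optimum_def cong: image_cong_simp)

text \<open>Maximum and minimum are monotone and commute with adding a constant, so a uniform error
  \<open>e\<close> passes through either.\<close>

lemma optimum_mono:
  assumes "finite C" "C \<noteq> {}" "\<And>c. c \<in> C \<Longrightarrow> f c \<le> f' c + e"
  shows "optimum b (f ` C) \<le> optimum b (f' ` C) + e"
proof (cases b)
  case True
  have "f c \<le> Max (f' ` C) + e" if "c \<in> C" for c
    using assms(3)[OF that] Max_ge[OF finite_imageI[OF assms(1)] imageI[OF that], of f'] by linarith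
  then show ?thesis using assms True by (simp add: optimum_def)
next
  case False
  have "Min (f ` C) - e \<le> f' c" if "c \<in> C" for c
    using assms(3)[OF that] Min_le[OF finite_imageI[OF assms(1)] imageI[OF that], of f] by linarith
  then have "Min (f ` C) - e \<le> Min (f' ` C)" using assms by simp
  then show ?thesis using False by (simp add: optimum_def)
qed

lemma optimum_affine:
  assumes "finite C" "C \<noteq> {}" "a \<ge> 0"
  shows "optimum b ((\<lambda>c. a * (s + f c)) ` C) = a * (s + optimum b (f ` C))"
proof -
  have "mono (\<lambda>x. a * (s + x))" using assms(3) by (intro monoI mult_left_mono) auto
  from mono_Max_commute[OF this, of "f ` C"] mono_Min_commute[OF this, of "f ` C"]
  show ?thesis using assms by (simp add: optimum_def image_image)
qed

lemma optimum_measurable: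
  fixes f :: "'c \<Rightarrow> 'x \<Rightarrow> real"
  assumes "finite C" "\<And>c. c \<in> C \<Longrightarrow> f c \<in> borel_measurable N"
  shows "(\<lambda>x. optimum b ((\<lambda>c. f c x) ` C)) \<in> borel_measurable N"
  using assms by (cases b) (auto simp: optimum_def intro!: borel_measurable_Max borel_measurable_Min)

section \<open>Monotonicity, decomposition and locality of tree values\<close>

text \<open>Every play meets exactly one vertex of each later level, so errors depending only on the
  level add up along a play, not over all vertices. Levels start right after that of
  \<open>z\<close>, because the payoff at the starting vertex is not collected.\<close>

lemma tree_value_mono:
  assumes "d \<ge> 1" "z \<in> dtree d"
    and "\<And>w. w \<in> dtree d \<Longrightarrow> length w > length z \<Longrightarrow> g w \<le> g' w + c (length w)"
    and "\<And>w. w \<in> dtree d \<Longrightarrow> length w = length z + n \<Longrightarrow> u w \<le> u' w + e"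
  shows "tree_value d g u b n z \<le> tree_value d g' u' b n z + (\<Sum>i<n. c (length z + Suc i)) + e"
  using assms(2-)
proof (induction n arbitrary: b z)
  case (Suc n)
  have "tree_value d g u b (Suc n) z
      \<le> tree_value d g' u' b (Suc n) z + ((\<Sum>i<Suc n. c (length z + Suc i)) + e)"
    unfolding tree_value.simps
  proof (rule optimum_mono[OF finite_children children_nonempty[OF assms(1)]])
    fix w assume w: "w \<in> children d z"
    then have wt: "w \<in> dtree d" and len: "length w = Suc (length z)"
      using children_subset[OF Suc.prems(1)] length_children by auto
    have "tree_value d g u (\<not> b) n w
        \<le> tree_value d g' u' (\<not> b) n w + (\<Sum>i<n. c (length w + Suc i)) + e"
      by (rule Suc.IH[OF wt]) (use Suc.prems len in auto)
    moreover have "g w \<le> g' w + c (length w)" by (rule Suc.prems) (use wt len in auto)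
    ultimately show "g w + tree_value d g u (\<not> b) n w
        \<le> g' w + tree_value d g' u' (\<not> b) n w + ((\<Sum>i<Suc n. c (length z + Suc i)) + e)"
      unfolding len by (simp add: sum.lessThan_Suc_shift del: sum.lessThan_Suc)
  qed
  then show ?case by simp
qed auto

lemma tree_value_mono_const:
  assumes "d \<ge> 1" "z \<in> dtree d" "\<And>w. w \<in> dtree d \<Longrightarrow> g w \<le> g' w + a"
    and "\<And>w. w \<in> dtree d \<Longrightarrow> length w = length z + n \<Longrightarrow> u w \<le> u' w + e"
  shows "tree_value d g u b n z \<le> tree_value d g' u' b n z + real n * a + e"
  using tree_value_mono[OF assms(1,2), of g g' "\<lambda>_. a" n u u' e b] assms(3,4) by simp

lemma tree_value_zero:
  assumes "d \<ge> 1"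
  shows "tree_value d (\<lambda>_. 0) (\<lambda>_. 0) b n z = 0"
  using children_nonempty[OF assms]
  by (induction n arbitrary: b z) (auto simp: optimum_def image_constant_conv)

lemma tree_value_bounds:
  assumes "d \<ge> 1" "z \<in> dtree d" "\<And>w. w \<in> dtree d \<Longrightarrow> 0 \<le> g w" "\<And>w. w \<in> dtree d \<Longrightarrow> g w \<le> 1"
  shows "0 \<le> tree_value d g (\<lambda>_. 0) b n z" "tree_value d g (\<lambda>_. 0) b n z \<le> real n"
  using tree_value_mono_const[OF assms(1,2), of "\<lambda>_. 0" g 0 n "\<lambda>_. 0" "\<lambda>_. 0" 0 b]
    tree_value_mono_const[OF assms(1,2), of g "\<lambda>_. 0" 1 n "\<lambda>_. 0" "\<lambda>_. 0" 0 b] assms(3,4)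
  by (simp_all add: tree_value_zero[OF assms(1)])

text \<open>Dynamic programming: the last \<open>m\<close> stages influence the first
  \<open>n\<close> only through their value, used as terminal payoff. After \<open>n\<close>
  alternating moves Player 1 is to move exactly if \<open>b = even n\<close>.\<close>

lemma tree_value_add:
  "tree_value d g u b (n + m) z = tree_value d g (tree_value d g u (b = even n) m) b n z"
  by (induction n arbitrary: b z) (auto intro!: optimum_cong arg_cong[of _ _ "\<lambda>b. tree_value d g u b m _"] arg_cong2[of _ _ _ _ "\<lambda>v b. tree_value d g v b _ _"])

text \<open>Only data at descendants of \<open>z\<close> are read; this locality is what makes
  values in disjoint subtrees independent.\<close>

lemma tree_value_cong:
  assumes "\<And>w. w \<in> subtree d z \<Longrightarrow> g w = g' w" "\<And>w. w \<in> subtree d z \<Longrightarrow> u w = u' w"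
  shows "tree_value d g u b n z = tree_value d g' u' b n z"
  using assms
proof (induction n arbitrary: b z)
  case (Suc n)
  show ?case unfolding tree_value.simps
  proof (rule optimum_cong)
    fix c assume c: "c \<in> children d z"
    then have "subtree d c \<subseteq> subtree d z" using children_subtree subtree_mono by blast
    then have "tree_value d g u (\<not> b) n c = tree_value d g' u' (\<not> b) n c"
      by (intro Suc.IH Suc.prems) auto
    moreover have "g c = g' c" using c children_subtree by (intro Suc.prems) auto
    ultimately show "g c + tree_value d g u (\<not> b) n c = g' c + tree_value d g' u' (\<not> b) n c"
      by simp
  qed
qed auto

text \<open>Prefixing by \<open>y\<close> is an isomorphism of the tree onto its subtree at
  \<open>y\<close>. Hence values at different vertices are the same functional of translated
  payoffs.\<close>

lemma tree_value_shift:
  "tree_value d g u b n (y @ z) = tree_value d (\<lambda>w. g (y @ w)) (\<lambda>w. u (y @ w)) b n z"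
proof (induction n arbitrary: b z)
  case (Suc n)
  have "children d (y @ z) = (\<lambda>c. y @ c) ` children d z" by (auto simp: children_def)
  then show ?case using Suc by (simp add: image_image)
qed auto

lemma tree_value_measurable:
  assumes "\<And>w. w \<in> subtree d z \<Longrightarrow> (\<lambda>x. g x w) \<in> borel_measurable N"
    and "\<And>w. w \<in> subtree d z \<Longrightarrow> (\<lambda>x. u x w) \<in> borel_measurable N"
  shows "(\<lambda>x. tree_value d (g x) (u x) b n z) \<in> borel_measurable N"
  using assms
proof (induction n arbitrary: b z)
  case (Suc n)
  show ?case unfolding tree_value.simps
  proof (rule optimum_measurable[OF finite_children])
    fix c assume c: "c \<in> children d z"
    then have "subtree d c \<subseteq> subtree d z" using children_subtree subtree_mono by blast
    with Suc c children_subtree[of d z]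
    show "(\<lambda>x. g x c + tree_value d (g x) (u x) (\<not> b) n c) \<in> borel_measurable N"
      by (intro borel_measurable_add) (auto intro!: Suc.IH)
  qed
qed auto

section \<open>Relation to the value of the game\<close>

text \<open>The payoffs already collected along a history are a constant that moves out of the
  optimum. The sum starts at index \<open>1\<close> because nothing is paid at the initial vertex; a
  history of odd length means that Player 1 moves.\<close>

lemma backward_value_eq_tree_value:
  assumes "d \<ge> 1" "length h + k = Suc n" "h \<noteq> []"
  shows "backward_value d (\<lambda>h. (1 / real n) * (\<Sum>i=1..n. g (h ! i))) k h
    = (1 / real n) * ((\<Sum>i=1..<length h. g (h ! i))
        + tree_value d g (\<lambda>_. 0) (odd (length h)) k (last h))"
  using assms(2-)
proof (induction k arbitrary: h)
  case 0
  then have "{1..<length h} = {1..n}" by auto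
  then show ?case by simp
next
  case (Suc k)
  let ?B = "backward_value d (\<lambda>h. (1 / real n) * (\<Sum>i=1..n. g (h ! i)))"
  have "?B (Suc k) h = optimum (odd (length h)) ((\<lambda>c. ?B k (h @ [c])) ` children d (last h))"
    by (simp add: optimum_def)
  also have "\<dots> = optimum (odd (length h)) ((\<lambda>c. (1 / real n) * ((\<Sum>i=1..<length h. g (h ! i))
      + (g c + tree_value d g (\<lambda>_. 0) (even (length h)) k c))) ` children d (last h))"
  proof (rule optimum_cong)
    fix c assume "c \<in> children d (last h)"
    have "(\<Sum>i=1..<length h. g ((h @ [c]) ! i)) = (\<Sum>i=1..<length h. g (h ! i))"
      by (intro sum.cong) (auto simp: nth_append)
    moreover have "1 \<le> length h" using Suc.prems by (cases h) auto
    moreover have "?B k (h @ [c]) = (1 / real n) * ((\<Sum>i=1..<length (h @ [c]). g ((h @ [c]) ! i))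
        + tree_value d g (\<lambda>_. 0) (odd (length (h @ [c]))) k (last (h @ [c])))"
      by (rule Suc.IH) (use Suc.prems in auto)
    ultimately show "?B k (h @ [c]) = (1 / real n) * ((\<Sum>i=1..<length h. g (h ! i))
      + (g c + tree_value d g (\<lambda>_. 0) (even (length h)) k c))"
      using Suc.prems by (simp add: nth_append ring_distribs add_divide_distrib)
  qed
  also have "\<dots> = (1 / real n) * ((\<Sum>i=1..<length h. g (h ! i))
      + tree_value d g (\<lambda>_. 0) (odd (length h)) (Suc k) (last h))"
    by (subst optimum_affine) (use children_nonempty[OF assms(1)] in \<open>auto simp: finite_children\<close>)
  finally show ?case .
qed

lemma game_value_eq_tree_value:
  assumes "d \<ge> 1" "z0 \<in> dtree d"
  shows "game_value d g z0 n = tree_value d g (\<lambda>_. 0) True n z0 / real n"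
  using game_value_eq(1)[OF assms, of g n] backward_value_eq_tree_value[OF assms(1), of "[z0]" n n g]
  by simp



subsection \<open>Bounded differences\<close>

text \<open>An elementary form of the Efron--Stein inequality.\<close>

lemma second_moment_bounded_differences:
  fixes N :: "'i \<Rightarrow> 'a measure" and F :: "('i \<Rightarrow> 'a) \<Rightarrow> real"
  assumes N: "\<And>i. prob_space (N i)" and "finite I"
    and "F \<in> borel_measurable (PiM I N)"
    and "\<And>x. x \<in> space (PiM I N) \<Longrightarrow> \<bar>F x\<bar> \<le> B"
    and "\<And>i x y. i \<in> I \<Longrightarrow> x \<in> space (PiM I N) \<Longrightarrow> y \<in> space (N i) \<Longrightarrow> \<bar>F (x(i := y)) - F x\<bar> \<le> 1"
  shows "(\<integral>x. (F x)\<^sup>2 \<partial>PiM I N) \<le> (\<integral>x. F x \<partial>PiM I N)\<^sup>2 + real (card I)"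
  using assms(2-)
proof (induction I arbitrary: F rule: finite_induct)
  case empty
  interpret product_prob_space N UNIV
    using N by (simp add: product_prob_space_def product_prob_space_axioms_def product_sigma_finite_def prob_space_imp_sigma_finite)
  show ?case by (simp add: PiM_empty lebesgue_integral_count_space_finite)
next
  case (insert i I)
  interpret product_prob_space N UNIV
    using N by (simp add: product_prob_space_def product_prob_space_axioms_def product_sigma_finite_def prob_space_imp_sigma_finite)
  interpret Q: prob_space "PiM J N" for J by (rule prob_space_PiM) (rule N)
  note [measurable] = insert.prems(1)
  \<comment> \<open>Coordinate \<open>i\<close> is integrated out: the second moment of
    \<open>F\<close> is that of \<open>H\<close> plus the mean variance of \<open>F\<close> along
    coordinate \<open>i\<close>.\<close>
  define H where "H x = (\<integral>y. F (x(i := y)) \<partial>N i)" for x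
  have upd: "x(i := y) \<in> space (PiM (insert i I) N)" if "x \<in> space (PiM I N)" "y \<in> space (N i)" for x y
    using that by (auto simp: space_PiM PiE_iff extensional_def)
  have B: "\<bar>F (x(i := y))\<bar> \<le> B" if "x \<in> space (PiM I N)" "y \<in> space (N i)" for x y
    using insert.prems(2)[OF upd[OF that]] .
  have B0: "0 \<le> B" using Q.not_empty insert.prems(2) by (smt (verit) ex_in_conv)
  have m2[measurable]: "(\<lambda>(x, y). F (x(i := y))) \<in> borel_measurable (PiM I N \<Otimes>\<^sub>M N i)"
    using measurable_comp[OF measurable_add_dim[of i I N] insert.prems(1)]
    by (simp add: comp_def case_prod_beta)
  have m1[measurable]: "(\<lambda>y. F (x(i := y))) \<in> borel_measurable (N i)" if "x \<in> space (PiM I N)" for x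
    using measurable_compose_Pair1[OF that m2] by simp
  have H[measurable]: "H \<in> borel_measurable (PiM I N)"
    unfolding H_def using M.borel_measurable_lebesgue_integral[OF m2] by simp
  have int: "integrable (N i) (\<lambda>y. F (x(i := y)))" if "x \<in> space (PiM I N)" for x
    by (rule M.integrable_const_bound[of _ B]) (use B that in auto)
  have int2: "integrable (N i) (\<lambda>y. (F (x(i := y)))\<^sup>2)" if "x \<in> space (PiM I N)" for x
    by (rule M.integrable_const_bound[of _ "B\<^sup>2"]) (use B B0 that in \<open>auto intro!: power2_le_iff_abs_le[THEN iffD2]\<close>)
  have HB: "\<bar>H x\<bar> \<le> B" if "x \<in> space (PiM I N)" for x
  proof -
    have "F (x(i := y)) \<le> B" "- B \<le> F (x(i := y))" if "y \<in> space (N i)" for y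
      using B[OF \<open>x \<in> space (PiM I N)\<close> that] by auto
    then have "H x \<le> B" "- B \<le> H x"
      unfolding H_def by (auto intro!: M.integral_le_const M.integral_ge_const int[OF that])
    then show ?thesis by simp
  qed
  \<comment> \<open>All values along coordinate \<open>i\<close> lie within \<open>1\<close> of any
    one of them, hence so does their mean, and the variance along this coordinate is at most
    \<open>1\<close>.\<close>
  have var: "(\<integral>y. (F (x(i := y)))\<^sup>2 \<partial>N i) \<le> (H x)\<^sup>2 + 1" if x: "x \<in> space (PiM I N)" for x
  proof -
    have dev: "(F (x(i := y)) - H x)\<^sup>2 \<le> 1" if y: "y \<in> space (N i)" for y
    proof -
      have d: "F (x(i := y')) \<le> F (x(i := y)) + 1" "F (x(i := y)) - 1 \<le> F (x(i := y'))"
        if "y' \<in> space (N i)" for y'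
        using insert.prems(3)[of i "x(i := y)" y'] upd[OF x y] that by (auto simp del: fun_upd_apply)
      have "H x \<le> F (x(i := y)) + 1" "F (x(i := y)) - 1 \<le> H x"
        unfolding H_def using d
        by (auto intro!: M.integral_le_const M.integral_ge_const int[OF x])
      then show ?thesis by (simp add: abs_square_le_1 abs_le_iff)
    qed
    have "(\<integral>y. (F (x(i := y)))\<^sup>2 \<partial>N i) = (H x)\<^sup>2 + (\<integral>y. (F (x(i := y)) - H x)\<^sup>2 \<partial>N i)"
      using M.variance_eq[OF int[OF x] int2[OF x]] unfolding H_def by simp
    also have "(\<integral>y. (F (x(i := y)) - H x)\<^sup>2 \<partial>N i) \<le> 1"
    proof (rule M.integral_le_const)
      show "integrable (N i) (\<lambda>y. (F (x(i := y)) - H x)\<^sup>2)"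
        by (rule M.integrable_const_bound[of _ 1]) (use dev x in auto)
    qed (use dev in auto)
    finally show ?thesis by simp
  qed
  \<comment> \<open>Averaging over coordinate \<open>i\<close> preserves bounded differences in the
    other coordinates, so the induction hypothesis applies to \<open>H\<close>.\<close>
  have "(\<integral>x. (H x)\<^sup>2 \<partial>PiM I N) \<le> (\<integral>x. H x \<partial>PiM I N)\<^sup>2 + real (card I)"
  proof (rule insert.IH[OF H HB])
    fix j x y assume j: "j \<in> I" and x: "x \<in> space (PiM I N)" and y: "y \<in> space (N j)"
    have x': "x(j := y) \<in> space (PiM I N)" using j x y by (auto simp: space_PiM PiE_iff extensional_def)
    have "H (x(j := y)) - H x = (\<integral>y'. F ((x(j := y))(i := y')) - F (x(i := y')) \<partial>N i)"
      unfolding H_def by (rule Bochner_Integration.integral_diff[symmetric]) (use int x x' in auto)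
    moreover have "F ((x(j := y))(i := y')) - F (x(i := y')) \<le> 1"
      "- 1 \<le> F ((x(j := y))(i := y')) - F (x(i := y'))" if "y' \<in> space (N i)" for y'
    proof -
      have "(x(j := y))(i := y') = (x(i := y'))(j := y)"
        using j insert.hyps by (auto simp: fun_upd_twist)
      then have "\<bar>F ((x(j := y))(i := y')) - F (x(i := y'))\<bar> \<le> 1"
        using insert.prems(3)[of j "x(i := y')" y] upd[OF x that] j y by (simp del: fun_upd_apply)
      then show "F ((x(j := y))(i := y')) - F (x(i := y')) \<le> 1"
        "- 1 \<le> F ((x(j := y))(i := y')) - F (x(i := y'))" by auto
    qed
    then have "(\<integral>y'. F ((x(j := y))(i := y')) - F (x(i := y')) \<partial>N i) \<le> 1"
      "-1 \<le> (\<integral>y'. F ((x(j := y))(i := y')) - F (x(i := y')) \<partial>N i)"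
      by (auto intro!: M.integral_le_const M.integral_ge_const Bochner_Integration.integrable_diff int x x')
    ultimately show "\<bar>H (x(j := y)) - H x\<bar> \<le> 1" by simp
  qed
  moreover have "(\<integral>x. F x \<partial>PiM (insert i I) N) = (\<integral>x. H x \<partial>PiM I N)"
    unfolding H_def
    by (rule product_integral_insert[OF insert.hyps])
       (rule Q.integrable_const_bound[of _ B], use insert.prems in auto)
  moreover have "(\<integral>x. (F x)\<^sup>2 \<partial>PiM (insert i I) N) = (\<integral>x. (\<integral>y. (F (x(i := y)))\<^sup>2 \<partial>N i) \<partial>PiM I N)"
    by (rule product_integral_insert[OF insert.hyps])
       (rule Q.integrable_const_bound[of _ "B\<^sup>2"],
        use insert.prems B0 in \<open>auto intro!: power2_le_iff_abs_le[THEN iffD2]\<close>)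
  moreover have "(\<integral>x. (\<integral>y. (F (x(i := y)))\<^sup>2 \<partial>N i) \<partial>PiM I N) \<le> (\<integral>x. (H x)\<^sup>2 + 1 \<partial>PiM I N)"
  proof (rule integral_mono)
    show iH: "integrable (PiM I N) (\<lambda>x. (H x)\<^sup>2 + 1)"
      by (rule Q.integrable_const_bound[of _ "B\<^sup>2 + 1"])
         (use HB B0 in \<open>auto intro!: power2_le_iff_abs_le[THEN iffD2]\<close>)
    show "integrable (PiM I N) (\<lambda>x. \<integral>y. (F (x(i := y)))\<^sup>2 \<partial>N i)"
    proof (rule Bochner_Integration.integrable_bound[OF iH])
      have "(\<lambda>(x, y). (F (x(i := y)))\<^sup>2) \<in> borel_measurable (PiM I N \<Otimes>\<^sub>M N i)"
        using borel_measurable_power[OF m2, of 2] by (simp add: case_prod_beta)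
      from M.borel_measurable_lebesgue_integral[OF this]
      show "(\<lambda>x. \<integral>y. (F (x(i := y)))\<^sup>2 \<partial>N i) \<in> borel_measurable (PiM I N)" by simp
      show "AE x in PiM I N. norm (\<integral>y. (F (x(i := y)))\<^sup>2 \<partial>N i) \<le> norm ((H x)\<^sup>2 + 1)"
        using var by (intro AE_I2) (auto simp: integral_nonneg_AE)
    qed
  qed (use var in auto)
  moreover have "(\<integral>x. (H x)\<^sup>2 + 1 \<partial>PiM I N) = (\<integral>x. (H x)\<^sup>2 \<partial>PiM I N) + 1"
    by (subst Bochner_Integration.integral_add)
       (auto simp: Q.prob_space intro!: Q.integrable_const_bound[of _ "B\<^sup>2"] power2_le_iff_abs_le[THEN iffD2] HB B0)
  ultimately show ?case using insert.hyps by simp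
qed



subsection \<open>Approximately additive sequences\<close>

text \<open>The dyadic averages \<open>a (2 ^ k * n) / 2 ^ k\<close> form a Cauchy sequence with
  geometrically small increments. Their limit is exactly additive in \<open>n\<close>, hence linear,
  and stays close to \<open>a n\<close>.\<close>

lemma approx_additive_imp_approx_linear:
  fixes a :: "nat \<Rightarrow> real"
  assumes C: "\<And>n m. \<bar>a (n + m) - a n - a m\<bar> \<le> C * sqrt (real (n + m))"
  obtains v where "\<And>n. \<bar>a n - v * real n\<bar> \<le> 4 * C * sqrt (real n)"
proof -
  have C0: "0 \<le> C" using order_trans[OF abs_ge_zero C[of 1 0]] by simp
  \<comment> \<open>An error of order \<open>sqrt (2 ^ k * n)\<close>, divided by
    \<open>2 ^ k\<close>, equals \<open>sqrt n * r ^ k\<close>, which is geometric in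
    \<open>k\<close>.\<close>
  define r where "r = (1 / sqrt 2 :: real)"
  have r: "0 < r" "r < 1" "r \<le> 3/4" "r * r = 1/2"
  proof -
    have "4/3 \<le> sqrt 2" by (rule real_le_rsqrt) (simp add: power2_eq_square)
    then have "1 / sqrt 2 \<le> 1 / (4/3)" by (intro divide_left_mono) auto
    then show "0 < r" "r < 1" "r \<le> 3/4" by (auto simp: r_def)
  qed (simp add: r_def)
  define b where "b n k = a (2 ^ k * n) / 2 ^ k" for n k
  have sq: "sqrt (real (2 ^ k * n)) / 2 ^ k = sqrt (real n) * r ^ k" for k n
  proof -
    have "sqrt 2 * r = 1" by (simp add: r_def)
    then have one: "sqrt (2 ^ k) * r ^ k = 1"
      by (metis power_mult_distrib power_one real_sqrt_power)
    have "2 ^ k * (sqrt (real n) * r ^ k) = sqrt (2 ^ k) * sqrt (2 ^ k) * (sqrt (real n) * r ^ k)"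
      by (subst real_sqrt_mult_self) simp
    also have "\<dots> = sqrt (2 ^ k) * sqrt (real n) * (sqrt (2 ^ k) * r ^ k)"
      by (simp only: mult_ac)
    also have "\<dots> = sqrt (real (2 ^ k * n))"
      unfolding one by (simp add: real_sqrt_mult)
    finally have "sqrt (real (2 ^ k * n)) = 2 ^ k * (sqrt (real n) * r ^ k)" by (rule sym)
    then show ?thesis by simp
  qed
  have step: "\<bar>b n (Suc k) - b n k\<bar> \<le> C * sqrt (real n) * r * r ^ k" for n k
  proof -
    have two: "2 ^ Suc k * n = 2 ^ k * n + 2 ^ k * n" by simp
    have "b n (Suc k) - b n k = (a (2 ^ k * n + 2 ^ k * n) - a (2 ^ k * n) - a (2 ^ k * n)) / 2 ^ Suc k"
      unfolding b_def two by (simp add: diff_divide_distrib)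
    then have "\<bar>b n (Suc k) - b n k\<bar> \<le> C * sqrt (real (2 ^ k * n + 2 ^ k * n)) / 2 ^ Suc k"
      using C[of "2 ^ k * n" "2 ^ k * n"] by (simp add: abs_divide divide_right_mono)
    also have "\<dots> = C * (sqrt (real (2 ^ Suc k * n)) / 2 ^ Suc k)" unfolding two by simp
    also have "\<dots> = C * (sqrt (real n) * r ^ Suc k)" unfolding sq ..
    finally show ?thesis by (simp add: mult_ac)
  qed
  have summ: "summable (\<lambda>k. C * sqrt (real n) * r * r ^ k)" for n
    using r by (intro summable_mult summable_geometric) auto
  have sumd: "summable (\<lambda>k. b n (Suc k) - b n k)" for n
    by (rule summable_comparison_test'[OF summ[of n], of 0]) (use step in auto)
  define L where "L n = a n + (\<Sum>k. b n (Suc k) - b n k)" for n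
  have lim: "b n \<longlonglongrightarrow> L n" for n
  proof -
    have "(\<lambda>m. \<Sum>k<m. b n (Suc k) - b n k) \<longlonglongrightarrow> (\<Sum>k. b n (Suc k) - b n k)"
      using sumd by (rule summable_LIMSEQ)
    then have "(\<lambda>m. b n m - b n 0) \<longlonglongrightarrow> (\<Sum>k. b n (Suc k) - b n k)"
      by (simp add: sum_lessThan_telescope)
    from tendsto_add[OF tendsto_const[of "b n 0"] this] show ?thesis
      by (simp add: L_def b_def[of n 0])
  qed
  have bound: "\<bar>a n - L n\<bar> \<le> 4 * C * sqrt (real n)" for n
  proof -
    have "\<bar>\<Sum>k. b n (Suc k) - b n k\<bar> \<le> (\<Sum>k. C * sqrt (real n) * r * r ^ k)"
      using norm_suminf_le[of "\<lambda>k. b n (Suc k) - b n k", OF _ summ[of n]] step by simp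
    also have "\<dots> = C * sqrt (real n) * (r / (1 - r))"
      using r by (subst suminf_mult) (auto simp: suminf_geometric summable_geometric)
    \<comment> \<open>Since \<open>r\<close> is at most 3/4, the ratio \<open>r / (1 - r)\<close> is
      at most 3.\<close>
    also have "\<dots> \<le> C * sqrt (real n) * 4"
      using r C0 by (intro mult_left_mono) (auto simp: field_simps)
    finally show ?thesis by (simp add: L_def mult_ac)
  qed
  \<comment> \<open>The additivity defect at scale \<open>2 ^ k\<close> vanishes after division by
    \<open>2 ^ k\<close>.\<close>
  have add: "L (n + m) = L n + L m" for n m
  proof -
    have "(\<lambda>k. b (n + m) k - b n k - b m k) \<longlonglongrightarrow> 0"
    proof (rule Lim_null_comparison)
      show "(\<lambda>k. C * sqrt (real (n + m)) * r ^ k) \<longlonglongrightarrow> 0"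
        using r by (intro tendsto_mult_right_zero LIMSEQ_power_zero) auto
      have "\<bar>b (n + m) k - b n k - b m k\<bar> \<le> C * sqrt (real (n + m)) * r ^ k" for k
      proof -
        have "b (n + m) k - b n k - b m k = (a (2 ^ k * n + 2 ^ k * m) - a (2 ^ k * n) - a (2 ^ k * m)) / 2 ^ k"
          by (simp add: b_def field_simps)
        then have "\<bar>b (n + m) k - b n k - b m k\<bar> \<le> C * sqrt (real (2 ^ k * n + 2 ^ k * m)) / 2 ^ k"
          using C[of "2 ^ k * n" "2 ^ k * m"] by (simp add: abs_divide divide_right_mono)
        also have "\<dots> = C * (sqrt (real (2 ^ k * (n + m))) / 2 ^ k)" by (simp add: algebra_simps)
        also have "\<dots> = C * (sqrt (real (n + m)) * r ^ k)" unfolding sq ..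
        finally show ?thesis by simp
      qed
      then show "\<forall>\<^sub>F k in sequentially. norm (b (n + m) k - b n k - b m k) \<le> C * sqrt (real (n + m)) * r ^ k"
        by simp
    qed
    moreover have "(\<lambda>k. b (n + m) k - b n k - b m k) \<longlonglongrightarrow> L (n + m) - L n - L m"
      by (intro tendsto_diff lim)
    ultimately have "L (n + m) - L n - L m = 0" by (rule LIMSEQ_unique[rotated])
    then show ?thesis by simp
  qed
  have lin: "L n = L 1 * real n" for n
  proof (induction n)
    case 0 show ?case using add[of 0 0] by simp
  next
    case (Suc n) then show ?case using add[of n 1] by (simp add: algebra_simps)
  qed
  show ?thesis by (rule that[of "L 1"], subst lin[symmetric], rule bound)
qed


section \<open>Elementary estimates for the number of wasted stages\<close>

text \<open>Lets a \<open>k\<close> of order \<open>sqrt (n * d)\<close> already satisfy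
  \<open>n * d \<le> 2 ^ k\<close>, as the union bound over a level demands.\<close>

lemma square_le_four_two_power: "(real k)\<^sup>2 \<le> 4 * 2 ^ k"
proof (induction k)
  case (Suc k)
  show ?case
  proof (cases "k \<ge> 3")
    case True
    then have "2 * real k + 1 \<le> real k * real k"
      using mult_right_mono[of 3 "real k" "real k"] by linarith
    then have "(real (Suc k))\<^sup>2 \<le> 2 * (real k)\<^sup>2"
      by (simp add: power2_eq_square algebra_simps)
    with Suc show ?thesis by simp
  next
    case False
    then consider "k = 0" | "k = 1" | "k = 2" by linarith
    then show ?thesis by cases (auto simp: power2_eq_square)
  qed
qed simp

lemma real_nat_ceiling_le: "0 \<le> x \<Longrightarrow> real (nat \<lceil>x\<rceil>) \<le> x + 1"
  using of_int_ceiling_le_add_one[of x] by simp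

subsection \<open>Games with independent payoffs\<close>

text \<open>The payoffs are bounded at every outcome, so that the deterministic estimates hold
  pointwise; payoffs that are bounded only almost surely are clamped first.\<close>

locale iid_tree_payoffs = prob_space M for M :: "'w measure" +
  fixes d :: nat and G :: "nat list \<Rightarrow> 'w \<Rightarrow> real" and \<mu> :: "real measure"
  assumes d: "2 \<le> d"
    and indep: "indep_vars (\<lambda>_. borel) G (dtree d)"
    and ident: "\<And>z. z \<in> dtree d \<Longrightarrow> distr M borel (G z) = \<mu>"
    and G_nonneg: "\<And>z \<omega>. 0 \<le> G z \<omega>"
    and G_le_1: "\<And>z \<omega>. G z \<omega> \<le> 1"
begin

text \<open>Player 1 always moves first, so splitting off an initial block into values of the same
  kind requires an even number of stages in that block.\<close>

definition val :: "nat \<Rightarrow> nat list \<Rightarrow> 'w \<Rightarrow> real" where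
  "val n z \<omega> = tree_value d (\<lambda>w. G w \<omega>) (\<lambda>_. 0) True n z"

lemma d1: "1 \<le> d"
  using d by simp

lemma Nil_dtree [simp]: "[] \<in> dtree d"
  by (simp add: dtree_def)

lemma subtree_Nil: "subtree d [] = dtree d"
  by (simp add: subtree_def)

lemma G_measurable: "z \<in> dtree d \<Longrightarrow> G z \<in> borel_measurable M"
  using indep by (auto simp: indep_vars_def)

lemma val_measurable [measurable]: "z \<in> dtree d \<Longrightarrow> val n z \<in> borel_measurable M"
  unfolding val_def[abs_def]
  by (rule tree_value_measurable) (use G_measurable subtree_dtree in auto)

lemma val_bounds:
  assumes "z \<in> dtree d"
  shows "0 \<le> val n z \<omega>" "val n z \<omega> \<le> real n"
  unfolding val_def using tree_value_bounds[OF d1 assms] G_nonneg G_le_1 by auto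

lemma val_integrable:
  assumes [measurable]: "z \<in> dtree d"
  shows "integrable M (val n z)" "integrable M (\<lambda>\<omega>. (val n z \<omega>)\<^sup>2)"
  by (rule integrable_const_bound[of _ "real n"], use val_bounds[OF assms, of n] in auto)
     (rule integrable_const_bound[of _ "(real n)\<^sup>2"], use val_bounds[OF assms, of n] in \<open>auto intro!: power_mono\<close>)

lemma val_add:
  "even n \<Longrightarrow> val (n + m) z \<omega> = tree_value d (\<lambda>w. G w \<omega>) (\<lambda>w. val m w \<omega>) True n z"
  unfolding val_def by (subst tree_value_add) simp

text \<open>The additional \<open>j\<close> stages act as a terminal payoff between \<open>0\<close>
  and \<open>j\<close>, whoever moves first in them.\<close>

lemma val_mono:
  assumes "z \<in> dtree d"
  shows "val n z \<omega> \<le> val (n + j) z \<omega>" "val (n + j) z \<omega> \<le> val n z \<omega> + real j"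
proof -
  let ?g = "\<lambda>w. G w \<omega>"
  let ?u = "tree_value d ?g (\<lambda>_. 0) (True = even n) j"
  have u: "0 \<le> ?u w" "?u w \<le> 0 + real j" if "w \<in> dtree d" for w
    using tree_value_bounds[OF d1 that] G_nonneg G_le_1 by auto
  have eq: "val (n + j) z \<omega> = tree_value d ?g ?u True n z"
    unfolding val_def by (rule tree_value_add)
  show "val n z \<omega> \<le> val (n + j) z \<omega>" "val (n + j) z \<omega> \<le> val n z \<omega> + real j"
    unfolding eq unfolding val_def
    using tree_value_mono_const[OF d1 assms, of ?g ?g 0 n "\<lambda>_. 0" ?u 0 True]
      tree_value_mono_const[OF d1 assms, of ?g ?g 0 n ?u "\<lambda>_. 0" "real j" True] u
    by auto
qed

section \<open>Law, variance and independence of the values\<close>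

text \<open>The value at \<open>z\<close> is one fixed functional of the payoffs translated from the
  subtree at \<open>z\<close> to the root, and the translated family has the same product
  law.\<close>

lemma distr_val:
  assumes z: "z \<in> dtree d"
  shows "distr M borel (val n z) = distr M borel (val n [])"
proof -
  let ?P = "PiM (dtree d) (\<lambda>_. borel :: real measure)"
  define \<Phi> where "\<Phi> = (\<lambda>x. tree_value d x (\<lambda>_. 0) True n [])"
  have \<Phi>: "\<Phi> \<in> borel_measurable ?P"
    unfolding \<Phi>_def
    by (rule tree_value_measurable[where g = "\<lambda>x. x"]) (auto simp: subtree_Nil)
  have \<mu>: "prob_space \<mu>"
    using ident[OF Nil_dtree] prob_space_distr[OF G_measurable[OF Nil_dtree]] by simp
  have shift: "distr M borel (val n y) = distr (PiM (dtree d) (\<lambda>_. \<mu>)) borel \<Phi>" if y: "y \<in> dtree d" for y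
  proof -
    let ?S = "PiM (subtree d y) (\<lambda>_. borel :: real measure)"
    have yw: "y @ w \<in> subtree d y" "y @ w \<in> dtree d" if "w \<in> dtree d" for w
      using that y by (auto simp: subtree_def dtree_def)
    have R: "(\<lambda>x. \<lambda>w\<in>dtree d. x (y @ w)) \<in> measurable ?S ?P"
      by (intro measurable_restrict measurable_component_singleton yw)
    have S: "(\<lambda>\<omega>. \<lambda>w\<in>subtree d y. G w \<omega>) \<in> measurable M ?S"
      by (intro measurable_restrict G_measurable subtree_dtree[OF y, THEN subsetD])
    have "distr M ?S (\<lambda>\<omega>. \<lambda>w\<in>subtree d y. G w \<omega>) = PiM (subtree d y) (\<lambda>w. distr M borel (G w))"
      using subtree_dtree[OF y]
      by (intro indep_vars_iff_distr_eq_PiM'[THEN iffD1] indep_vars_subset[OF indep])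
         (use self_in_subtree[of y d] in \<open>auto intro!: G_measurable simp del: self_in_subtree\<close>)
    also have "\<dots> = PiM (subtree d y) (\<lambda>_. \<mu>)"
      by (intro PiM_cong refl ident subtree_dtree[OF y, THEN subsetD])
    finally have law: "distr M ?S (\<lambda>\<omega>. \<lambda>w\<in>subtree d y. G w \<omega>) = PiM (subtree d y) (\<lambda>_. \<mu>)" .
    have "PiM (dtree d) (\<lambda>_. \<mu>)
        = distr (PiM (subtree d y) (\<lambda>_. \<mu>)) (PiM (dtree d) (\<lambda>_. \<mu>)) (\<lambda>x. \<lambda>w\<in>dtree d. x (y @ w))"
      by (rule distr_PiM_reindex[symmetric]) (use \<mu> yw in \<open>auto intro: inj_onI\<close>)
    \<comment> \<open>Only the target changes: the product of copies of \<open>\<mu>\<close> and the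
      product of Borel algebras have the same measurable sets.\<close>
    also have "\<dots> = distr (PiM (subtree d y) (\<lambda>_. \<mu>)) ?P (\<lambda>x. \<lambda>w\<in>dtree d. x (y @ w))"
      using ident[OF Nil_dtree] by (intro distr_cong sets_PiM_cong) auto
    also have "\<dots> = distr M ?P ((\<lambda>x. \<lambda>w\<in>dtree d. x (y @ w)) \<circ> (\<lambda>\<omega>. \<lambda>w\<in>subtree d y. G w \<omega>))"
      unfolding law[symmetric] by (rule distr_distr[OF R S])
    finally have "distr (PiM (dtree d) (\<lambda>_. \<mu>)) borel \<Phi>
        = distr M borel (\<Phi> \<circ> ((\<lambda>x. \<lambda>w\<in>dtree d. x (y @ w)) \<circ> (\<lambda>\<omega>. \<lambda>w\<in>subtree d y. G w \<omega>)))"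
      using distr_distr[OF \<Phi> measurable_comp[OF S R]] by simp
    also have "\<Phi> \<circ> ((\<lambda>x. \<lambda>w\<in>dtree d. x (y @ w)) \<circ> (\<lambda>\<omega>. \<lambda>w\<in>subtree d y. G w \<omega>)) = val n y"
    proof
      fix \<omega>
      have "val n y \<omega> = tree_value d (\<lambda>w. G (y @ w) \<omega>) (\<lambda>_. 0) True n []"
        unfolding val_def using tree_value_shift[of d _ _ True n y "[]"] by simp
      also have "\<dots> = \<Phi> (\<lambda>w\<in>dtree d. (\<lambda>w\<in>subtree d y. G w \<omega>) (y @ w))"
        unfolding \<Phi>_def by (rule tree_value_cong) (auto simp: subtree_Nil yw)
      finally show "(\<Phi> \<circ> ((\<lambda>x. \<lambda>w\<in>dtree d. x (y @ w)) \<circ> (\<lambda>\<omega>. \<lambda>w\<in>subtree d y. G w \<omega>))) \<omega> = val n y \<omega>"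
        by simp
    qed
    finally show ?thesis by simp
  qed
  show ?thesis using shift[OF z] shift[OF Nil_dtree] by simp
qed

lemma prob_val_eq:
  assumes z: "z \<in> dtree d" and S: "S \<in> sets borel"
  shows "prob {\<omega> \<in> space M. val n z \<omega> \<in> S} = prob {\<omega> \<in> space M. val n [] \<omega> \<in> S}"
proof -
  have "prob {\<omega> \<in> space M. val n y \<omega> \<in> S} = measure (distr M borel (val n y)) S" if "y \<in> dtree d" for y
    using S that by (subst measure_distr) (auto intro!: arg_cong[of _ _ prob])
  then show ?thesis using z distr_val[OF z] by simp
qed

text \<open>The independent coordinates are whole levels rather than single vertices. There are only
  \<open>n\<close> of them, and changing one moves the value by at most \<open>1\<close>, because a
  play visits a single vertex of that level.\<close>

lemma second_moment_val:
  "(\<integral>\<omega>. (val n [] \<omega>)\<^sup>2 \<partial>M) \<le> (\<integral>\<omega>. val n [] \<omega> \<partial>M)\<^sup>2 + real n"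
proof -
  define K where "K i = {w \<in> dtree d. length w = i}" for i
  define L where "L i \<omega> = (\<lambda>w\<in>K i. G w \<omega>)" for i \<omega>
  let ?S = "\<lambda>i. PiM (K i) (\<lambda>_. borel :: real measure)"
  let ?N = "\<lambda>i. distr M (?S i) (L i)"
  have iL: "indep_vars ?S L {1..n}"
    unfolding L_def
    by (rule indep_vars_restrict[OF indep]) (auto simp: K_def disjoint_family_on_def)
  have mL: "L i \<in> measurable M (?S i)" for i
    unfolding L_def by (intro measurable_restrict G_measurable) (auto simp: K_def)
  have mLL: "(\<lambda>\<omega>. \<lambda>i\<in>{1..n}. L i \<omega>) \<in> measurable M (PiM {1..n} ?S)"
    by (intro measurable_restrict mL)
  \<comment> \<open>Clamping the payoffs makes the bounded differences hold on the whole product space.\<close>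
  define \<Phi> :: "(nat \<Rightarrow> nat list \<Rightarrow> real) \<Rightarrow> real" where
    "\<Phi> = (\<lambda>x. tree_value d (\<lambda>w. max 0 (min 1 (if length w \<in> {1..n} then x (length w) w else 0))) (\<lambda>_. 0) True n [])"
  have comp: "(\<lambda>x. if length w \<in> {1..n} then x (length w) w else 0) \<in> borel_measurable (PiM {1..n} ?S)"
    if "w \<in> dtree d" for w
  proof (cases "length w \<in> {1..n}")
    case True
    have "w \<in> K (length w)" using that by (simp add: K_def)
    then have "(\<lambda>x. x (length w) w) \<in> borel_measurable (PiM {1..n} ?S)"
      using measurable_compose[OF measurable_component_singleton[OF True, of ?S]
        measurable_component_singleton[of w "K (length w)" "\<lambda>_. borel"]] by simp
    with True show ?thesis by simp
  qed auto
  have \<Phi>: "\<Phi> \<in> borel_measurable (PiM {1..n} ?S)"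
    unfolding \<Phi>_def
    by (rule tree_value_measurable)
       (use comp in \<open>auto simp only: subtree_Nil intro!: borel_measurable_max borel_measurable_min borel_measurable_const\<close>)
  have \<Phi>': "\<Phi> \<in> borel_measurable (PiM {1..n} ?N)"
    using \<Phi> by (simp cong: measurable_cong_sets sets_PiM_cong)
  \<comment> \<open>Independence says that the joint law is a product. The case
    \<open>n = 0\<close>, with no level at all, is settled at the end, where the value is
    \<open>0\<close>.\<close>
  have law: "distr M (PiM {1..n} ?S) (\<lambda>\<omega>. \<lambda>i\<in>{1..n}. L i \<omega>) = PiM {1..n} ?N" if "n > 0"
    using indep_vars_iff_distr_eq_PiM'[of "{1..n}" L ?S] that mL iL by simp
  have val: "val n [] \<omega> = \<Phi> (\<lambda>i\<in>{1..n}. L i \<omega>)" for \<omega>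
  proof (rule antisym)
    have *: "max 0 (min 1 (if length w \<in> {1..n} then (\<lambda>i\<in>{1..n}. L i \<omega>) (length w) w else 0))
      = (if length w \<in> {1..n} then G w \<omega> else 0)" if "w \<in> dtree d" for w
      using that by (auto simp: L_def K_def G_nonneg G_le_1)
    let ?g = "\<lambda>w. max 0 (min 1 (if length w \<in> {1..n} then (\<lambda>i\<in>{1..n}. L i \<omega>) (length w) w else 0))"
    \<comment> \<open>The error \<open>1\<close> occurs only outside levels \<open>1\<close> to
      \<open>n\<close>, which no play of \<open>n\<close> stages from the root reaches, so its sum
      vanishes.\<close>
    let ?c = "\<lambda>i. if i \<in> {1..n} then 0 else 1 :: real"
    have "G w \<omega> \<le> ?g w + ?c (length w)" if "w \<in> dtree d" for w
      unfolding *[OF that] using G_le_1[of w \<omega>] by auto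
    then have "tree_value d (\<lambda>w. G w \<omega>) (\<lambda>_. 0) True n []
        \<le> tree_value d ?g (\<lambda>_. 0) True n [] + (\<Sum>i<n. ?c (length ([] :: nat list) + Suc i)) + 0"
      by (intro tree_value_mono[OF d1 Nil_dtree]) auto
    then show "val n [] \<omega> \<le> \<Phi> (\<lambda>i\<in>{1..n}. L i \<omega>)"
      unfolding val_def \<Phi>_def by simp
    show "\<Phi> (\<lambda>i\<in>{1..n}. L i \<omega>) \<le> val n [] \<omega>"
    proof -
      have "?g w \<le> G w \<omega> + 0" if "w \<in> dtree d" for w
        unfolding *[OF that] using G_nonneg[of w \<omega>] by auto
      then have "tree_value d ?g (\<lambda>_. 0) True n []
          \<le> tree_value d (\<lambda>w. G w \<omega>) (\<lambda>_. 0) True n [] + real n * 0 + 0"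
        by (intro tree_value_mono_const[OF d1 Nil_dtree]) auto
      then show ?thesis unfolding val_def \<Phi>_def by simp
    qed
  qed
  have bd: "\<Phi> x \<le> \<Phi> x' + 1" if x: "\<And>j. j \<noteq> i \<Longrightarrow> x j = x' j" for x x' i
  proof -
    let ?g = "\<lambda>x w. max 0 (min 1 (if length w \<in> {1..n} then x (length w) w else 0)) :: real"
    let ?c = "\<lambda>j. if j = i then 1 else 0 :: real"
    have "?g x w \<le> ?g x' w + ?c (length w)" for w
      using x[of "length w"] by auto
    then have "\<Phi> x \<le> \<Phi> x' + (\<Sum>j<n. ?c (length ([] :: nat list) + Suc j)) + 0"
      unfolding \<Phi>_def by (intro tree_value_mono[OF d1 Nil_dtree]) auto
    \<comment> \<open>Stage \<open>j + 1\<close> is the only one that reaches level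
      \<open>j + 1\<close>, so level \<open>i\<close> counts once, at \<open>j = i - 1\<close>;
      level \<open>0\<close> never counts.\<close>
    also have "(\<Sum>j<n. ?c (length ([] :: nat list) + Suc j))
        = (\<Sum>j<n. (if i - 1 = j then (if i = 0 then 0 else 1) else 0))"
      by (intro sum.cong) auto
    also have "\<dots> \<le> 1" by simp
    finally show ?thesis by simp
  qed
  have \<Phi>_bound: "\<bar>\<Phi> x\<bar> \<le> real n" for x
    unfolding \<Phi>_def
    using tree_value_bounds[OF d1 Nil_dtree, of "\<lambda>w. max 0 (min 1 (if length w \<in> {1..n} then x (length w) w else 0))" True n]
    by auto
  show ?thesis
  proof (cases "n > 0")
    case True
    have "(\<integral>x. (\<Phi> x)\<^sup>2 \<partial>PiM {1..n} ?N) \<le> (\<integral>x. \<Phi> x \<partial>PiM {1..n} ?N)\<^sup>2 + real (card {1..n})"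
    proof (intro second_moment_bounded_differences prob_space_distr mL \<Phi>' finite_atLeastAtMost)
      fix x i y
      show "\<bar>\<Phi> (x(i := y)) - \<Phi> x\<bar> \<le> 1"
        using bd[of i "x(i := y)" x] bd[of i x "x(i := y)"] by (simp add: abs_le_iff)
    qed (rule \<Phi>_bound)
    moreover have "(\<integral>x. (\<Phi> x)\<^sup>2 \<partial>PiM {1..n} ?N) = (\<integral>\<omega>. (val n [] \<omega>)\<^sup>2 \<partial>M)"
      unfolding law[OF True, symmetric] val using \<Phi> mLL by (intro integral_distr) auto
    moreover have "(\<integral>x. \<Phi> x \<partial>PiM {1..n} ?N) = (\<integral>\<omega>. val n [] \<omega> \<partial>M)"
      unfolding law[OF True, symmetric] val using \<Phi> mLL by (intro integral_distr) auto
    ultimately show ?thesis by simp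
  next
    case False
    then show ?thesis by (simp add: val_def)
  qed
qed

text \<open>Subtrees at distinct children of \<open>z\<close> are disjoint, so they carry disjoint
  families of independent payoffs.\<close>

lemma indep_subtrees:
  assumes "z \<in> dtree d"
    and "\<And>i. i < d \<Longrightarrow> \<Phi> i \<in> borel_measurable (PiM (subtree d (z @ [i])) (\<lambda>_. borel))"
  shows "indep_vars (\<lambda>_. borel) (\<lambda>i \<omega>. \<Phi> i (\<lambda>w\<in>subtree d (z @ [i]). G w \<omega>)) {..<d}"
proof -
  have "indep_vars (\<lambda>i. PiM (subtree d (z @ [i])) (\<lambda>_. borel))
      (\<lambda>i \<omega>. \<lambda>w\<in>subtree d (z @ [i]). G w \<omega>) {..<d}"
    using assms(1)
    by (intro indep_vars_restrict[OF indep]) (auto simp: subtree_def dtree_def disjoint_family_on_def)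
  from indep_vars_compose2[OF this, of \<Phi> "\<lambda>_. borel"] show ?thesis using assms(2) by simp
qed

subsection \<open>Doubly exponential tails\<close>

definition mean :: "nat \<Rightarrow> real" where
  "mean n = (\<integral>\<omega>. val n [] \<omega> \<partial>M)"

lemma mean_bounds: "0 \<le> mean n" "mean n \<le> real n"
  unfolding mean_def
  using val_bounds[OF Nil_dtree] val_integrable(1)[OF Nil_dtree]
  by (auto intro!: integral_le_const integral_nonneg)

lemma mean_mono: "mean n \<le> mean (n + j)" "mean (n + j) \<le> mean n + real j"
proof -
  show "mean n \<le> mean (n + j)"
    unfolding mean_def by (intro integral_mono val_integrable Nil_dtree val_mono)
  have "mean (n + j) \<le> (\<integral>\<omega>. val n [] \<omega> + real j \<partial>M)"
    unfolding mean_def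
    by (intro integral_mono val_integrable Nil_dtree val_mono Bochner_Integration.integrable_add integrable_const)
  also have "\<dots> = mean n + real j"
    unfolding mean_def
    by (subst Bochner_Integration.integral_add) (auto intro: val_integrable simp: prob_space)
  finally show "mean (n + j) \<le> mean n + real j" .
qed

text \<open>With variance at most \<open>n\<close>, Chebyshev's inequality bounds the probability of
  a deviation by \<open>dev n\<close> by \<open>1 / (4 * d^2)\<close>, the starting value of the
  tail recursion.\<close>

definition dev :: "nat \<Rightarrow> real" where
  "dev n = 2 * real d * sqrt (real n)"

text \<open>The weight \<open>d^2\<close> is chosen because it turns the recursion \<open>p\<close>
  to \<open>(d * p)^2\<close> into plain squaring of \<open>d^2 * p\<close>.\<close>

lemma prob_val_deviation:
  assumes z: "z \<in> dtree d"
  shows "(real d)\<^sup>2 * prob {\<omega> \<in> space M. val n z \<omega> < mean n - dev n} \<le> 1 / 4"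
    and "(real d)\<^sup>2 * prob {\<omega> \<in> space M. val n z \<omega> > mean n + dev n} \<le> 1 / 4"
proof -
  have "(real d)\<^sup>2 * prob {\<omega> \<in> space M. val n [] \<omega> \<in> {..<mean n - dev n} \<union> {mean n + dev n<..}} \<le> 1 / 4"
  \<comment> \<open>For \<open>n = 0\<close> the value, its mean and \<open>dev\<close> all vanish,
    so neither strict deviation can occur.\<close>
  proof (cases "n = 0")
    case True
    then show ?thesis by (simp add: val_def mean_def dev_def prob_space)
  next
    case False
    then have dev: "0 < dev n" using d by (simp add: dev_def)
    have "prob {\<omega> \<in> space M. val n [] \<omega> \<in> {..<mean n - dev n} \<union> {mean n + dev n<..}}
        \<le> prob {\<omega> \<in> space M. \<bar>val n [] \<omega> - mean n\<bar> \<ge> dev n}"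
      by (rule finite_measure_mono) auto
    also have "\<dots> \<le> variance (val n []) / (dev n)\<^sup>2"
      unfolding mean_def by (rule Chebyshev_inequality) (use dev val_integrable[OF Nil_dtree] in auto)
    also have "\<dots> \<le> real n / (dev n)\<^sup>2"
      using second_moment_val[of n] val_integrable[OF Nil_dtree]
      by (intro divide_right_mono) (simp_all add: variance_eq)
    also have "\<dots> = 1 / (4 * (real d)\<^sup>2)"
      using False by (simp add: dev_def power_mult_distrib)
    finally show ?thesis using d by (simp add: field_simps)
  qed
  moreover have "prob {\<omega> \<in> space M. val n z \<omega> \<in> S}
      \<le> prob {\<omega> \<in> space M. val n [] \<omega> \<in> {..<mean n - dev n} \<union> {mean n + dev n<..}}"
    if "S \<in> sets borel" "S \<subseteq> {..<mean n - dev n} \<union> {mean n + dev n<..}" for S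
    unfolding prob_val_eq[OF z that(1)] using that(2) by (intro finite_measure_mono) auto
  from this[of "{..<mean n - dev n}"] this[of "{mean n + dev n<..}"]
  have "prob {\<omega> \<in> space M. val n z \<omega> < mean n - dev n}
      \<le> prob {\<omega> \<in> space M. val n [] \<omega> \<in> {..<mean n - dev n} \<union> {mean n + dev n<..}}"
    and "prob {\<omega> \<in> space M. val n z \<omega> > mean n + dev n}
      \<le> prob {\<omega> \<in> space M. val n [] \<omega> \<in> {..<mean n - dev n} \<union> {mean n + dev n<..}}"
    by simp_all
  ultimately show "(real d)\<^sup>2 * prob {\<omega> \<in> space M. val n z \<omega> < mean n - dev n} \<le> 1 / 4"
    "(real d)\<^sup>2 * prob {\<omega> \<in> space M. val n z \<omega> > mean n + dev n} \<le> 1 / 4"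
    by (meson mult_left_mono order_trans zero_le_power2)+
qed

lemma child_dtree: "z \<in> dtree d \<Longrightarrow> i < d \<Longrightarrow> z @ [i] \<in> dtree d"
  by (simp add: dtree_def)

lemma val_restrict:
  "w \<in> subtree d z \<Longrightarrow> val n w \<omega> = tree_value d (\<lambda>w\<in>subtree d z. G w \<omega>) (\<lambda>_. 0) True n w"
  unfolding val_def by (rule tree_value_cong) (use subtree_mono[of w d z] in auto)

lemma tree_value_restrict_measurable:
  "w \<in> subtree d z \<Longrightarrow>
    (\<lambda>x. tree_value d x (\<lambda>_. 0) True n w) \<in> borel_measurable (PiM (subtree d z) (\<lambda>_. borel))"
  by (rule tree_value_measurable[where g = "\<lambda>x. x"]) (use subtree_mono[of w d z] in auto)

lemma grandchild_subtree: "i < d \<Longrightarrow> z @ [j, i] \<in> subtree d (z @ [j])"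
  by (auto simp: subtree_def dtree_def intro!: image_eqI[of _ _ "[i]"])

section \<open>Boosting the tails by two extra stages\<close>

text \<open>Replacing the payoffs of the first two stages by zero lowers the value by an amount
  between \<open>0\<close> and \<open>2\<close>.\<close>

lemma val_two_stages:
  assumes z: "z \<in> dtree d"
  shows "val (m + 2) z \<omega> \<ge> (MAX i\<in>{..<d}. MIN j\<in>{..<d}. val m (z @ [i, j]) \<omega>)"
    and "val (m + 2) z \<omega> \<le> (MAX i\<in>{..<d}. MIN j\<in>{..<d}. val m (z @ [i, j]) \<omega>) + 2"
proof -
  have eq: "(MAX i\<in>{..<d}. MIN j\<in>{..<d}. val m (z @ [i, j]) \<omega>)
      = tree_value d (\<lambda>_. 0) (\<lambda>w. val m w \<omega>) True 2 z"
    by (simp add: numeral_2_eq_2 optimum_def children_def image_image)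
  have "val (m + 2) z \<omega> = tree_value d (\<lambda>w. G w \<omega>) (\<lambda>w. val m w \<omega>) True 2 z"
    using val_add[of 2 m z \<omega>] by (simp add: add.commute)
  then show "val (m + 2) z \<omega> \<ge> (MAX i\<in>{..<d}. MIN j\<in>{..<d}. val m (z @ [i, j]) \<omega>)"
    "val (m + 2) z \<omega> \<le> (MAX i\<in>{..<d}. MIN j\<in>{..<d}. val m (z @ [i, j]) \<omega>) + 2"
    unfolding eq
    using tree_value_mono_const[OF d1 z, of "\<lambda>_. 0" "\<lambda>w. G w \<omega>" 0 2 "\<lambda>w. val m w \<omega>" "\<lambda>w. val m w \<omega>" 0 True]
      tree_value_mono_const[OF d1 z, of "\<lambda>w. G w \<omega>" "\<lambda>_. 0" 1 2 "\<lambda>w. val m w \<omega>" "\<lambda>w. val m w \<omega>" 0 True]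
      G_nonneg G_le_1
    by auto
qed

text \<open>Player 1 fails to reach \<open>x\<close> only if each child has a bad grandchild below
  it. These are \<open>d\<close> independent events, each of probability at most
  \<open>d * p\<close> by a union bound.\<close>

lemma prob_val_less_step:
  assumes z: "z \<in> dtree d"
    and p: "\<And>w. w \<in> dtree d \<Longrightarrow> prob {\<omega> \<in> space M. val m w \<omega> < x} \<le> p"
  shows "prob {\<omega> \<in> space M. val (m + 2) z \<omega> < x} \<le> (real d * p) ^ d"
proof -
  define Y where "Y i \<omega> = (MIN j\<in>{..<d}. val m (z @ [i, j]) \<omega>)" for i \<omega>
  have ne: "{..<d} \<noteq> {}" using d by (auto simp: lessThan_empty_iff)
  have [measurable]: "z @ [i, j] \<in> dtree d" if "i < d" "j < d" for i j
    using z that by (simp add: dtree_def)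
  have iY: "indep_vars (\<lambda>_. borel) Y {..<d}"
  proof -
    have "indep_vars (\<lambda>_. borel) (\<lambda>i \<omega>. (\<lambda>x. MIN j\<in>{..<d}. tree_value d x (\<lambda>_. 0) True m (z @ [i, j]))
        (\<lambda>w\<in>subtree d (z @ [i]). G w \<omega>)) {..<d}"
      by (intro indep_subtrees[OF z] borel_measurable_Min tree_value_restrict_measurable)
         (auto simp: grandchild_subtree)
    then show ?thesis
      unfolding Y_def[abs_def] by (simp add: val_restrict[OF grandchild_subtree] cong: image_cong_simp)
  qed
  have mY: "Y i \<in> borel_measurable M" if "i < d" for i
    using iY that by (auto simp: indep_vars_def)
  have "prob {\<omega> \<in> space M. val (m + 2) z \<omega> < x} \<le> prob (\<Inter>i\<in>{..<d}. Y i -` {..<x} \<inter> space M)"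
  proof (rule finite_measure_mono)
    show "{\<omega> \<in> space M. val (m + 2) z \<omega> < x} \<subseteq> (\<Inter>i\<in>{..<d}. Y i -` {..<x} \<inter> space M)"
    proof clarsimp
      fix \<omega> i assume "val (Suc (Suc m)) z \<omega> < x" "i < d"
      then have "(MAX i\<in>{..<d}. Y i \<omega>) < x"
        using val_two_stages(1)[OF z, of m \<omega>] by (simp add: Y_def)
      then show "Y i \<omega> < x"
        using ne \<open>i < d\<close> by (subst (asm) Max_less_iff) auto
    qed
    show "(\<Inter>i\<in>{..<d}. Y i -` {..<x} \<inter> space M) \<in> events"
      using ne mY by (intro sets.finite_INT measurable_sets) auto
  qed
  also have "\<dots> = (\<Prod>i<d. prob (Y i -` {..<x} \<inter> space M))"
    by (rule indep_varsD[OF iY ne]) auto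
  also have "\<dots> \<le> (\<Prod>i<d. real d * p)"
  proof (intro prod_mono conjI measure_nonneg)
    fix i assume "i \<in> {..<d}"
    then have i: "i < d" by simp
    have "prob (Y i -` {..<x} \<inter> space M) = prob (\<Union>j<d. {\<omega> \<in> space M. val m (z @ [i, j]) \<omega> < x})"
      using Min_less_iff[of "(\<lambda>j. val m (z @ [i, j]) _) ` {..<d}" x] ne
      by (intro arg_cong[of _ _ prob]) (auto simp: Y_def)
    also have "\<dots> \<le> (\<Sum>j<d. prob {\<omega> \<in> space M. val m (z @ [i, j]) \<omega> < x})"
      using i by (intro finite_measure_subadditive_finite) auto
    also have "\<dots> \<le> (\<Sum>j<d. p)"
      by (intro sum_mono p) (use i z in \<open>auto simp: dtree_def\<close>)
    finally show "prob (Y i -` {..<x} \<inter> space M) \<le> real d * p" by simp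
  qed
  finally show ?thesis by simp
qed

text \<open>Player 2 fails only if some child has nothing but bad children: \<open>d\<close>
  independent events for a fixed child, then a union bound over the child. The \<open>2\<close>
  allows for what Player 1 collects in the two stages.\<close>

lemma prob_val_greater_step:
  assumes z: "z \<in> dtree d"
    and p: "\<And>w. w \<in> dtree d \<Longrightarrow> prob {\<omega> \<in> space M. val m w \<omega> > x} \<le> p"
  shows "prob {\<omega> \<in> space M. val (m + 2) z \<omega> > x + 2} \<le> real d * p ^ d"
proof -
  have ne: "{..<d} \<noteq> {}" using d by (auto simp: lessThan_empty_iff)
  have [measurable]: "z @ [i, j] \<in> dtree d" if "i < d" "j < d" for i j
    using z that by (simp add: dtree_def)
  define B where "B i = (\<Inter>j\<in>{..<d}. val m (z @ [i, j]) -` {x<..} \<inter> space M)" for i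
  have B: "B i \<in> events" if "i < d" for i
    unfolding B_def using ne that by (intro sets.finite_INT measurable_sets[of _ _ borel]) auto
  have "prob {\<omega> \<in> space M. val (m + 2) z \<omega> > x + 2} \<le> prob (\<Union>i<d. B i)"
  proof (rule finite_measure_mono)
    show "{\<omega> \<in> space M. val (m + 2) z \<omega> > x + 2} \<subseteq> (\<Union>i<d. B i)"
    proof
      fix \<omega> assume "\<omega> \<in> {\<omega> \<in> space M. val (m + 2) z \<omega> > x + 2}"
      then have \<omega>: "\<omega> \<in> space M" and "x < (MAX i\<in>{..<d}. MIN j\<in>{..<d}. val m (z @ [i, j]) \<omega>)"
        using val_two_stages(2)[OF z, of m \<omega>] by auto
      then have "\<exists>i\<in>{..<d}. x < (MIN j\<in>{..<d}. val m (z @ [i, j]) \<omega>)"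
        using ne by (subst (asm) Max_gr_iff) auto
      then show "\<omega> \<in> (\<Union>i<d. B i)"
        using ne \<omega> by (auto simp: B_def Min_gr_iff)
    qed
    show "(\<Union>i<d. B i) \<in> events" using B by auto
  qed
  also have "\<dots> \<le> (\<Sum>i<d. prob (B i))"
    using B by (intro finite_measure_subadditive_finite) auto
  also have "\<dots> \<le> (\<Sum>i<d. p ^ d)"
  proof (intro sum_mono)
    fix i assume "i \<in> {..<d}"
    then have i: "i < d" by simp
    have "indep_vars (\<lambda>_. borel) (\<lambda>j \<omega>. (\<lambda>x. tree_value d x (\<lambda>_. 0) True m ((z @ [i]) @ [j]))
        (\<lambda>w\<in>subtree d ((z @ [i]) @ [j]). G w \<omega>)) {..<d}"
      by (intro indep_subtrees[OF child_dtree[OF z i]] tree_value_restrict_measurable self_in_subtree)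
    then have iv: "indep_vars (\<lambda>_. borel) (\<lambda>j. val m (z @ [i, j])) {..<d}"
      by (simp only: val_restrict[OF self_in_subtree, symmetric] append_assoc append_Cons append_Nil)
    have "prob (B i) = (\<Prod>j<d. prob (val m (z @ [i, j]) -` {x<..} \<inter> space M))"
      unfolding B_def by (rule indep_varsD[OF iv ne]) auto
    also have "\<dots> \<le> (\<Prod>j<d. p)"
    proof (intro prod_mono conjI measure_nonneg)
      fix j assume "j \<in> {..<d}"
      then have "prob {\<omega> \<in> space M. val m (z @ [i, j]) \<omega> > x} \<le> p"
        by (intro p) (use i z in \<open>auto simp: dtree_def\<close>)
      then show "prob (val m (z @ [i, j]) -` {x<..} \<inter> space M) \<le> p"
        by (simp add: vimage_def Int_def conj_commute)
    qed
    finally show "prob (B i) \<le> p ^ d" by simp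
  qed
  finally show ?thesis by simp
qed

text \<open>The weighted probability starts below 1/4, hence below \<open>exp (- 1)\<close>, and
  each pair of stages at least squares it. Only the upper threshold rises, by \<open>2\<close> per
  pair.\<close>

lemma exp_neg_power_tails:
  assumes z: "z \<in> dtree d"
  shows "(real d)\<^sup>2 * prob {\<omega> \<in> space M. val (m + 2 * k) z \<omega> < mean m - dev m} \<le> exp (- (2 ^ k))"
    and "(real d)\<^sup>2 * prob {\<omega> \<in> space M. val (m + 2 * k) z \<omega> > mean m + dev m + real (2 * k)}
      \<le> exp (- (2 ^ k))"
proof -
  have e: "(1 / 4 :: real) \<le> exp (- 1)"
    using e_less_272 by (simp add: exp_minus field_simps)
  have sq: "(real d)\<^sup>2 * q \<le> exp (- (2 ^ Suc k))"
    if q: "q \<le> (real d * p)\<^sup>2" and p: "p = exp (- (2 ^ k)) / (real d)\<^sup>2" for p q and k :: nat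
  proof -
    have "(real d)\<^sup>2 * q \<le> (real d)\<^sup>2 * (real d * p)\<^sup>2"
      using q by (intro mult_left_mono) auto
    also have "\<dots> = (exp (- (2 ^ k)))\<^sup>2"
      using d by (simp add: p power2_eq_square)
    also have "\<dots> = exp (- (2 ^ Suc k))"
      by (simp add: power2_eq_square exp_add[symmetric])
    finally show ?thesis .
  qed
  \<comment> \<open>The step lemmas give exponent \<open>d\<close>; it is lowered to
    \<open>2\<close>, which needs bases at most \<open>1\<close>.\<close>
  have p1: "real d * p \<le> 1" "0 \<le> p" "p \<le> 1" if p: "p = exp (- (2 ^ k)) / (real d)\<^sup>2" for p and k :: nat
  proof -
    have "real d * p = exp (- (2 ^ k)) / real d" by (simp add: p power2_eq_square)
    also have "\<dots> \<le> 1 / real d" by (intro divide_right_mono) auto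
    also have "\<dots> \<le> 1" using d by simp
    finally show "real d * p \<le> 1" .
    moreover show "0 \<le> p" by (simp add: p)
    moreover have "1 * p \<le> real d * p" using d \<open>0 \<le> p\<close> by (intro mult_right_mono) auto
    ultimately show "p \<le> 1" by linarith
  qed
  have d2: "0 < (real d)\<^sup>2" using d by simp
  show "(real d)\<^sup>2 * prob {\<omega> \<in> space M. val (m + 2 * k) z \<omega> < mean m - dev m} \<le> exp (- (2 ^ k))"
    using z
  proof (induction k arbitrary: z)
    case 0
    then show ?case using prob_val_deviation(1)[OF 0, of m] e by simp
  next
    case (Suc k)
    define p where "p = exp (- (2 ^ k)) / (real d)\<^sup>2"
    note p1 = p1[OF p_def]
    have eq: "m + 2 * Suc k = (m + 2 * k) + 2" by simp
    have "prob {\<omega> \<in> space M. val ((m + 2 * k) + 2) z \<omega> < mean m - dev m} \<le> (real d * p) ^ d"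
      using Suc.IH d2 by (intro prob_val_less_step[OF Suc.prems]) (simp only: p_def pos_le_divide_eq mult.commute)
    also have "\<dots> \<le> (real d * p)\<^sup>2"
      using p1 d by (intro power_decreasing) auto
    finally show ?case unfolding eq by (rule sq[OF _ p_def])
  qed
  show "(real d)\<^sup>2 * prob {\<omega> \<in> space M. val (m + 2 * k) z \<omega> > mean m + dev m + real (2 * k)}
      \<le> exp (- (2 ^ k))"
    using z
  proof (induction k arbitrary: z)
    case 0
    then show ?case using prob_val_deviation(2)[OF 0, of m] e by simp
  next
    case (Suc k)
    define p where "p = exp (- (2 ^ k)) / (real d)\<^sup>2"
    note p1 = p1[OF p_def]
    have eq: "m + 2 * Suc k = (m + 2 * k) + 2"
      "mean m + dev m + real (2 * Suc k) = (mean m + dev m + real (2 * k)) + 2" by simp_all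
    have "prob {\<omega> \<in> space M. val ((m + 2 * k) + 2) z \<omega> > (mean m + dev m + real (2 * k)) + 2} \<le> real d * p ^ d"
      using Suc.IH d2 by (intro prob_val_greater_step[OF Suc.prems]) (simp only: p_def pos_le_divide_eq mult.commute)
    also have "\<dots> \<le> real d * p\<^sup>2"
      using p1 d by (intro mult_left_mono power_decreasing) auto
    also have "\<dots> \<le> (real d)\<^sup>2 * p\<^sup>2"
      using d by (intro mult_right_mono) (auto simp: power2_eq_square)
    finally show ?case
      unfolding eq using sq[OF _ p_def] by (simp only: power_mult_distrib)
  qed
qed

subsection \<open>The limit value\<close>

text \<open>The level has \<open>d ^ n\<close> vertices, at most \<open>exp (n * d)\<close>, which
  the doubly exponential bound outweighs once \<open>n * d \<le> 2 ^ k\<close>. The weight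
  \<open>d^2\<close>, at least 4, then yields 1/4.\<close>

lemma prob_level_union:
  assumes B: "\<And>z. z \<in> dtree d \<Longrightarrow> B z \<in> events"
    and p: "\<And>z. z \<in> dtree d \<Longrightarrow> (real d)\<^sup>2 * prob (B z) \<le> exp (- (2 ^ k))"
    and k: "real n * real d \<le> 2 ^ k"
  shows "prob (\<Union>z\<in>{z \<in> dtree d. length z = n}. B z) \<le> 1 / 4"
proof -
  let ?L = "{z \<in> dtree d. length z = n}"
  have L: "?L = {z. set z \<subseteq> {..<d} \<and> length z = n}"
    by (auto simp: dtree_def)
  have fin: "finite ?L" and card: "card ?L = d ^ n"
    unfolding L using card_lists_length_eq[of "{..<d}" n] finite_lists_length_eq[of "{..<d}" n] by auto
  have d2: "4 \<le> (real d)\<^sup>2" using d power_mono[of 2 "real d" 2] by simp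
  have "(real d)\<^sup>2 * prob (\<Union>z\<in>?L. B z) \<le> (real d)\<^sup>2 * (\<Sum>z\<in>?L. prob (B z))"
    by (intro mult_left_mono finite_measure_subadditive_finite fin) (use B in auto)
  also have "\<dots> = (\<Sum>z\<in>?L. (real d)\<^sup>2 * prob (B z))" by (rule sum_distrib_left)
  also have "\<dots> \<le> (\<Sum>z\<in>?L. exp (- (2 ^ k)))" by (intro sum_mono p) auto
  also have "\<dots> = real d ^ n * exp (- (2 ^ k))" by (simp add: card)
  also have "\<dots> \<le> exp (real d) ^ n * exp (- (2 ^ k))"
    by (intro mult_right_mono power_mono order_trans[OF _ exp_ge_add_one_self[of "real d"]]) auto
  also have "\<dots> = exp (real n * real d - 2 ^ k)"
    by (simp add: exp_of_nat_mult[symmetric] exp_add[symmetric])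
  also have "\<dots> \<le> 1" using k by simp
  finally have "(real d)\<^sup>2 * prob (\<Union>z\<in>?L. B z) \<le> 1" .
  moreover have "4 * prob (\<Union>z\<in>?L. B z) \<le> (real d)\<^sup>2 * prob (\<Union>z\<in>?L. B z)"
    by (intro mult_right_mono d2) auto
  ultimately show ?thesis by linarith
qed

lemma exists_outside_three:
  assumes "A \<in> events" "B \<in> events" "C \<in> events" "prob A \<le> 1 / 4" "prob B \<le> 1 / 4" "prob C \<le> 1 / 4"
  obtains \<omega> where "\<omega> \<in> space M" "\<omega> \<notin> A" "\<omega> \<notin> B" "\<omega> \<notin> C"
proof -
  have "prob (A \<union> B \<union> C) \<le> prob A + prob B + prob C"
    using measure_Un_le[of "A \<union> B" M C] measure_Un_le[of A M B] assms by auto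
  then have "prob (A \<union> B \<union> C) \<noteq> prob (space M)" using assms by (simp add: prob_space)
  moreover have "A \<union> B \<union> C \<subseteq> space M" using assms sets.sets_into_space by blast
  ultimately have "\<exists>\<omega>\<in>space M. \<omega> \<notin> A \<union> B \<union> C" by (metis subsetI subset_antisym)
  then show ?thesis using that by auto
qed

lemma prob_val_deviation_quarter:
  "prob {\<omega> \<in> space M. val n [] \<omega> < mean n - dev n} \<le> 1 / 4"
  "prob {\<omega> \<in> space M. val n [] \<omega> > mean n + dev n} \<le> 1 / 4"
proof -
  have *: "p \<le> 1 / 4" if "(real d)\<^sup>2 * p \<le> 1 / 4" "0 \<le> p" for p
    using mult_right_mono[of 1 "(real d)\<^sup>2" p] d that by (simp add: one_le_power)
  show "prob {\<omega> \<in> space M. val n [] \<omega> < mean n - dev n} \<le> 1 / 4"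
    "prob {\<omega> \<in> space M. val n [] \<omega> > mean n + dev n} \<le> 1 / 4"
    by (rule *[OF prob_val_deviation(1)[OF Nil_dtree] measure_nonneg],
        rule *[OF prob_val_deviation(2)[OF Nil_dtree] measure_nonneg])
qed

text \<open>
  The exceptional events have total probability less than \<open>1\<close>, so a single outcome outside of them
  suffices to compare the means.
\<close>

lemma mean_add_lower:
  assumes n: "even n" and k: "real n * real d \<le> 2 ^ k"
  shows "mean n + mean m - dev n - dev m - dev (n + (m + 2 * k)) \<le> mean (n + (m + 2 * k))"
proof -
  let ?N = "m + 2 * k"
  let ?A = "\<Union>z\<in>{z \<in> dtree d. length z = n}. {\<omega> \<in> space M. val ?N z \<omega> < mean m - dev m}"
  let ?B = "{\<omega> \<in> space M. val n [] \<omega> < mean n - dev n}"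
  let ?C = "{\<omega> \<in> space M. val (n + ?N) [] \<omega> > mean (n + ?N) + dev (n + ?N)}"
  have A: "?A \<in> events"
    by (intro sets.finite_UN finite_subset[OF _ finite_lists_length_eq[of "{..<d}" n]]) (auto simp: dtree_def)
  have BC: "?B \<in> events" "?C \<in> events" by simp_all
  have pA: "prob ?A \<le> 1 / 4"
    by (rule prob_level_union[OF _ exp_neg_power_tails(1) k]) auto
  obtain \<omega> where \<omega>: "\<omega> \<in> space M" "\<omega> \<notin> ?A" "\<omega> \<notin> ?B" "\<omega> \<notin> ?C"
    by (rule exists_outside_three[OF A BC pA prob_val_deviation_quarter(1) prob_val_deviation_quarter(2)])
  \<comment> \<open>Outside the first exceptional event every continuation at level \<open>n\<close>
    is worth at least \<open>mean m - dev m\<close>, so it may be replaced by this constant.\<close>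
  have "tree_value d (\<lambda>w. G w \<omega>) (\<lambda>_. 0) True n []
      \<le> tree_value d (\<lambda>w. G w \<omega>) (\<lambda>w. val ?N w \<omega>) True n [] + real n * 0 + (dev m - mean m)"
  proof (rule tree_value_mono_const[OF d1 Nil_dtree])
    fix w assume "w \<in> dtree d" "length w = length ([] :: nat list) + n"
    then have "\<not> val ?N w \<omega> < mean m - dev m" using \<omega>(1,2) by auto
    then show "0 \<le> val ?N w \<omega> + (dev m - mean m)" by simp
  qed simp
  then have "val n [] \<omega> + mean m - dev m \<le> val (n + ?N) [] \<omega>"
    unfolding val_add[OF n] unfolding val_def[of n] by simp
  with \<omega> show ?thesis by (simp add: not_less)
qed

text \<open>Mirror image of the lower bound, with the other tails. The additional
  \<open>2 * k\<close> comes from the raised threshold of the boosted upper tail.\<close>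

lemma mean_add_upper:
  assumes n: "even n" and k: "real n * real d \<le> 2 ^ k"
  shows "mean (n + (m + 2 * k)) \<le> mean n + mean m + dev n + dev m + dev (n + (m + 2 * k)) + real (2 * k)"
proof -
  let ?N = "m + 2 * k"
  let ?A = "\<Union>z\<in>{z \<in> dtree d. length z = n}. {\<omega> \<in> space M. val ?N z \<omega> > mean m + dev m + real (2 * k)}"
  let ?B = "{\<omega> \<in> space M. val n [] \<omega> > mean n + dev n}"
  let ?C = "{\<omega> \<in> space M. val (n + ?N) [] \<omega> < mean (n + ?N) - dev (n + ?N)}"
  have A: "?A \<in> events"
    by (intro sets.finite_UN finite_subset[OF _ finite_lists_length_eq[of "{..<d}" n]]) (auto simp: dtree_def)
  have BC: "?B \<in> events" "?C \<in> events" by simp_all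
  have pA: "prob ?A \<le> 1 / 4"
    by (rule prob_level_union[OF _ exp_neg_power_tails(2) k]) auto
  obtain \<omega> where \<omega>: "\<omega> \<in> space M" "\<omega> \<notin> ?A" "\<omega> \<notin> ?B" "\<omega> \<notin> ?C"
    by (rule exists_outside_three[OF A BC pA prob_val_deviation_quarter(2) prob_val_deviation_quarter(1)])
  have "tree_value d (\<lambda>w. G w \<omega>) (\<lambda>w. val ?N w \<omega>) True n []
      \<le> tree_value d (\<lambda>w. G w \<omega>) (\<lambda>_. 0) True n [] + real n * 0 + (mean m + dev m + real (2 * k))"
  proof (rule tree_value_mono_const[OF d1 Nil_dtree])
    fix w assume "w \<in> dtree d" "length w = length ([] :: nat list) + n"
    then have "\<not> val ?N w \<omega> > mean m + dev m + real (2 * k)" using \<omega>(1,2) by auto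
    then show "val ?N w \<omega> \<le> 0 + (mean m + dev m + real (2 * k))" by simp
  qed simp
  then have "val (n + ?N) [] \<omega> \<le> val n [] \<omega> + (mean m + dev m + real (2 * k))"
    unfolding val_add[OF n] unfolding val_def[of n] by simp
  with \<omega> show ?thesis by (simp add: not_less)
qed

lemma mean_approx_additive_even:
  assumes n: "even n"
  shows "\<bar>mean (n + m) - mean n - mean m\<bar> \<le> 24 * (real d)\<^sup>2 * sqrt (real (n + m))"
proof (cases "n + m = 0")
  case True
  then show ?thesis using mean_bounds[of 0] by simp
next
  case False
  define S where "S = sqrt (real (n + m))"
  have "1 \<le> n + m" using False by linarith
  then have S1: "1 \<le> S" unfolding S_def by (subst real_sqrt_ge_1_iff) linarith
  \<comment> \<open>With this choice \<open>n * d \<le> k^2 / 4 \<le> 2 ^ k\<close>, while the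
    \<open>2 * k\<close> wasted stages are still of order \<open>sqrt n\<close>.\<close>
  define k where "k = nat \<lceil>2 * sqrt (real n * real d)\<rceil>"
  have k: "2 * sqrt (real n * real d) \<le> real k" "real k \<le> 2 * sqrt (real n * real d) + 1"
    unfolding k_def by (rule real_nat_ceiling_ge, rule real_nat_ceiling_le) simp
  have "4 * (real n * real d) = (2 * sqrt (real n * real d))\<^sup>2"
    by (simp add: power_mult_distrib)
  also have "\<dots> \<le> (real k)\<^sup>2" using k by (intro power_mono) auto
  also have "\<dots> \<le> 4 * 2 ^ k" by (rule square_le_four_two_power)
  finally have nk: "real n * real d \<le> 2 ^ k" by simp
  have "sqrt (real d) \<le> real d" using d by (intro real_le_lsqrt) (auto simp: power2_eq_square)
  moreover have "sqrt (real n) \<le> S" by (simp add: S_def)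
  ultimately have "sqrt (real n * real d) \<le> S * real d"
    unfolding real_sqrt_mult using S1 by (intro mult_mono) auto
  moreover have dS: "S \<le> S * real d" using S1 d by simp
  moreover have "real (2 * k) = 2 * real k" by simp
  ultimately have k2: "real (2 * k) \<le> 6 * (S * real d)"
    using k S1 by linarith
  have "S * real d \<le> S * real d * real d" using dS mult_right_mono[OF dS, of "real d"] by simp
  then have dS2: "S * real d \<le> S * (real d)\<^sup>2" by (simp add: power2_eq_square mult.assoc)
  have "sqrt (real (2 * k)) \<le> real (2 * k)"
    by (cases "k = 0") (auto intro!: real_le_lsqrt simp: power2_eq_square)
  moreover have "sqrt (real (n + (m + 2 * k))) \<le> S + sqrt (real (2 * k))"
    using sqrt_add_le_add_sqrt[of "real (n + m)" "real (2 * k)"] by (simp add: S_def add.assoc)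
  ultimately have "sqrt (real (n + (m + 2 * k))) \<le> S + 6 * (S * real d)"
    using k2 by linarith
  then have "dev (n + (m + 2 * k)) \<le> 2 * real d * (S + 6 * (S * real d))"
    unfolding dev_def by (intro mult_left_mono) auto
  then have dN: "dev (n + (m + 2 * k)) \<le> 2 * (S * real d) + 12 * (S * (real d)\<^sup>2)"
    by (simp add: algebra_simps power2_eq_square)
  have dn: "dev n \<le> 2 * (S * real d)" "dev m \<le> 2 * (S * real d)"
    using mult_left_mono[of "sqrt (real n)" S "2 * real d"] mult_left_mono[of "sqrt (real m)" S "2 * real d"]
    by (auto simp: dev_def S_def mult_ac)
  have "mean (n + m) \<le> mean (n + (m + 2 * k))" "mean (n + (m + 2 * k)) \<le> mean (n + m) + real (2 * k)"
    using mean_mono[of "n + m" "2 * k"] by (simp_all add: add.assoc)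
  \<comment> \<open>The errors are \<open>2 * S * d\<close> for each of \<open>dev n\<close> and
    \<open>dev m\<close>, \<open>2 * S * d + 12 * S * d^2\<close> for the full game and
    \<open>6 * S * d\<close> for the wasted stages; together at most
    \<open>24 * S * d^2\<close>.\<close>
  then have "\<bar>mean (n + m) - mean n - mean m\<bar> \<le> 24 * (S * (real d)\<^sup>2)"
    using mean_add_lower[OF n nk, of m] mean_add_upper[OF n nk, of m] dN dn dS2 k2
    by linarith
  then show ?thesis by (simp add: S_def mult_ac)
qed

text \<open>An odd \<open>n\<close> is lowered by one. Two of the three means change, each by an
  amount in [0,1] and with opposite signs, so the defect changes by at most \<open>1\<close>, hence
  by at most \<open>sqrt (n + m)\<close>.\<close>

lemma mean_approx_additive:
  "\<bar>mean (n + m) - mean n - mean m\<bar> \<le> (24 * (real d)\<^sup>2 + 1) * sqrt (real (n + m))"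
proof (cases "even n")
  case True
  have "0 \<le> sqrt (real (n + m))" by simp
  then show ?thesis
    using mean_approx_additive_even[OF True, of m] unfolding distrib_right by linarith
next
  case False
  then obtain l where l: "n = l + 1" "even l" by (metis even_Suc odd_pos Suc_pred' Suc_eq_plus1)
  have "24 * (real d)\<^sup>2 * sqrt (real (l + m)) \<le> 24 * (real d)\<^sup>2 * sqrt (real (n + m))"
    by (intro mult_left_mono) (auto simp: l)
  moreover have "1 \<le> sqrt (real (n + m))" by (simp add: l)
  moreover have "mean l \<le> mean n" "mean n \<le> mean l + 1"
    "mean (l + m) \<le> mean (n + m)" "mean (n + m) \<le> mean (l + m) + 1"
    using mean_mono[of l 1] mean_mono[of "l + m" 1] by (simp_all add: l add_ac)
  ultimately show ?thesis
    using mean_approx_additive_even[OF l(2), of m] unfolding distrib_right by linarith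
qed

lemma mean_approx_linear:
  obtains v C where "0 \<le> v" "v \<le> 1" "0 \<le> C" "\<And>n. \<bar>mean n - v * real n\<bar> \<le> C * sqrt (real n)"
proof -
  define C where "C = 4 * (24 * (real d)\<^sup>2 + 1)"
  obtain v where v: "\<And>n. \<bar>mean n - v * real n\<bar> \<le> C * sqrt (real n)"
    using approx_additive_imp_approx_linear[OF mean_approx_additive] unfolding C_def by blast
  \<comment> \<open>At perfect squares the error is linear in \<open>N\<close>; dividing by
    \<open>N\<close> leaves bounds on multiples of \<open>v\<close> and \<open>v - 1\<close> that
    contradict \<open>v < 0\<close> or \<open>v > 1\<close> for large \<open>N\<close>.\<close>
  have lin: "- C \<le> v * real N" "(v - 1) * real N \<le> C" if "N > 0" for N
  proof -
    have "\<bar>mean (N * N) - v * real (N * N)\<bar> \<le> C * real N" using v[of "N * N"] by simp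
    then have "(- C) * real N \<le> (v * real N) * real N" "((v - 1) * real N) * real N \<le> C * real N"
      using mean_bounds[of "N * N"] by (auto simp: algebra_simps abs_le_iff)
    moreover have "0 < real N" using that by simp
    ultimately show "- C \<le> v * real N" "(v - 1) * real N \<le> C"
      by (simp_all only: mult_le_cancel_right_pos)
  qed
  have C: "0 < C" by (simp add: C_def add_nonneg_pos)
  have "0 \<le> v"
  proof (rule ccontr)
    assume "\<not> 0 \<le> v"
    then obtain N where N: "C < real N * (- v)" using ex_less_of_nat_mult[of "- v" C] by auto
    then have "N > 0" using C by (cases N) auto
    from lin(1)[OF this] N show False by (simp add: mult.commute)
  qed
  moreover have "v \<le> 1"
  proof (rule ccontr)
    assume "\<not> v \<le> 1"
    then obtain N where N: "C < real N * (v - 1)" using ex_less_of_nat_mult[of "v - 1" C] by auto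
    then have "N > 0" using C by (cases N) auto
    from lin(2)[OF this] N show False by (simp add: mult.commute)
  qed
  ultimately show ?thesis using that[of v C] C v by auto
qed

section \<open>Concentration and almost sure convergence\<close>

text \<open>About \<open>t^2 * n\<close> stages are wasted on boosting. They shift the thresholds by
  at most \<open>t^2 * n + 2\<close>, and the errors of order \<open>sqrt n\<close>, together with
  this \<open>2\<close>, are absorbed by \<open>K\<close>.\<close>

lemma concentration:
  assumes v: "0 \<le> v" "v \<le> 1" and C: "0 \<le> C" "\<And>n. \<bar>mean n - v * real n\<bar> \<le> C * sqrt (real n)"
    and z: "z \<in> dtree d" and n: "1 \<le> n" and t: "0 \<le> t"
    and K: "C + 2 * real d + 3 \<le> K"
  shows "prob {\<omega> \<in> space M. \<bar>val n z \<omega> / real n - v\<bar> \<ge> t + 2 * t\<^sup>2 + K / sqrt (real n)}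
    \<le> exp (- (1/6) * exp (t\<^sup>2 * real n / 4))" (is "prob ?E \<le> _")
proof (cases "t + 2 * t\<^sup>2 + K / sqrt (real n) > 1")
  case True
  \<comment> \<open>Both numbers lie in [0,1], so the event is empty once the threshold exceeds
    \<open>1\<close>.\<close>
  have "\<bar>val n z \<omega> / real n - v\<bar> \<le> 1" for \<omega>
  proof -
    have "0 \<le> val n z \<omega> / real n" "val n z \<omega> / real n \<le> 1"
      using val_bounds[OF z, of n \<omega>] n by (auto simp: divide_le_eq_1)
    then show ?thesis using v by auto
  qed
  then have E: "?E = {}" using True by (auto simp: not_le intro: le_less_trans)
  show ?thesis unfolding E by simp
next
  case False
  define s where "s = sqrt (real n)"
  have s: "s * s = real n" "1 \<le> s" using n by (auto simp: s_def)
  have K3: "3 \<le> K" using K C by simp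
  have "0 \<le> K / s" using K3 s by simp
  moreover have "0 \<le> 2 * t\<^sup>2" by simp
  ultimately have t2: "2 * t\<^sup>2 \<le> 1" "K / s \<le> 1" using False t unfolding s_def by linarith+
  then have "3 \<le> s" using s K3 by (simp add: field_simps)
  then have "9 \<le> real n" using mult_mono[of 3 s 3 s] s by simp
  \<comment> \<open>Since \<open>2 * t^2 \<le> 1\<close> and \<open>n \<ge> 9\<close>, rounding up
    still leaves \<open>2 * k \<le> n\<close>, so that many stages are available.\<close>
  define k where "k = nat \<lceil>t\<^sup>2 * real n / 2\<rceil>"
  have k: "t\<^sup>2 * real n / 2 \<le> real k" "real k \<le> t\<^sup>2 * real n / 2 + 1"
    unfolding k_def by (rule real_nat_ceiling_ge, rule real_nat_ceiling_le) simp
  have "2 * t\<^sup>2 * real n \<le> 1 * real n" using t2 by (intro mult_right_mono) auto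
  moreover have "real (2 * k) = 2 * real k" by simp
  ultimately have "real (2 * k) \<le> real n" using k \<open>9 \<le> real n\<close> by linarith
  then have "2 * k \<le> n" by linarith
  define m where "m = n - 2 * k"
  have nm: "n = m + 2 * k" using \<open>2 * k \<le> n\<close> by (simp add: m_def)
  have sm: "sqrt (real m) \<le> s" by (simp add: s_def nm)
  have Cm: "C * sqrt (real m) \<le> C * s" "dev m \<le> 2 * real d * s"
    unfolding dev_def using C sm by (auto intro!: mult_left_mono)
  have vm: "v * real m \<le> v * real n" "v * real n - real (2 * k) \<le> v * real m"
    using v mult_right_mono[of v 1 "real (2 * k)"] by (auto simp: nm algebra_simps)
  have Ks: "C * s + 2 * real d * s + 3 * s \<le> K * s"
    using mult_right_mono[OF K, of s] s by (simp add: algebra_simps)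
  have tn: "0 \<le> t * real n" "0 \<le> t\<^sup>2 * real n" using t by auto
  have thr: "(t + 2 * t\<^sup>2 + K / sqrt (real n)) * real n = t * real n + 2 * (t\<^sup>2 * real n) + K * s"
  proof -
    have "K / s * real n = K * s" using s by (simp add: s(1)[symmetric])
    then show ?thesis by (simp add: s_def distrib_right)
  qed
  have k2: "real (2 * k) \<le> t\<^sup>2 * real n + 2" using k by simp
  have m: "\<bar>mean m - v * real m\<bar> \<le> C * sqrt (real m)" by (rule C)
  let ?lo = "{\<omega> \<in> space M. val (m + 2 * k) z \<omega> < mean m - dev m}"
  let ?hi = "{\<omega> \<in> space M. val (m + 2 * k) z \<omega> > mean m + dev m + real (2 * k)}"
  have "?E \<subseteq> ?lo \<union> ?hi"
  proof
    fix \<omega> assume \<omega>: "\<omega> \<in> ?E"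
    then have "(t + 2 * t\<^sup>2 + K / sqrt (real n)) * real n \<le> \<bar>val n z \<omega> / real n - v\<bar> * real n"
      by (intro mult_right_mono) auto
    also have "\<dots> = \<bar>(val n z \<omega> / real n - v) * real n\<bar>" by (simp add: abs_mult)
    also have "(val n z \<omega> / real n - v) * real n = val n z \<omega> - v * real n"
      using n by (simp add: left_diff_distrib)
    finally have "t * real n + 2 * (t\<^sup>2 * real n) + K * s \<le> \<bar>val n z \<omega> - v * real n\<bar>"
      unfolding thr .
    then have "val n z \<omega> < mean m - dev m \<or> val n z \<omega> > mean m + dev m + real (2 * k)"
      using Cm vm Ks tn k2 m \<open>3 \<le> s\<close> by linarith
    then show "\<omega> \<in> ?lo \<union> ?hi" using \<omega> nm by auto
  qed
  then have "prob ?E \<le> prob (?lo \<union> ?hi)"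
    using z by (intro finite_measure_mono) auto
  also have "\<dots> \<le> prob ?lo + prob ?hi" using z by (intro measure_Un_le) auto
  also have "\<dots> \<le> exp (- (2 ^ k))"
  proof -
    \<comment> \<open>The weight \<open>d^2\<close>, at least 4, absorbs the sum of the two
      tails.\<close>
    have "4 * (prob ?lo + prob ?hi) \<le> (real d)\<^sup>2 * (prob ?lo + prob ?hi)"
      using d power_mono[of 2 "real d" 2] by (intro mult_right_mono) auto
    then show ?thesis
      using exp_neg_power_tails[OF z, of m k] exp_ge_zero[of "- (2 ^ k) :: real"]
      unfolding distrib_left by linarith
  qed
  also have "exp (- (2 ^ k)) \<le> exp (- (1/6) * exp (t\<^sup>2 * real n / 4))"
  proof -
    \<comment> \<open>From \<open>k \<ge> t^2 * n / 2\<close> and \<open>exp (1/2) \<le> 2\<close>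
      follows \<open>exp (t^2 * n / 4) \<le> 2 ^ k\<close>.\<close>
    have half: "exp (1 / 2 :: real) \<le> 2"
    proof (rule power2_le_imp_le)
      show "(exp (1 / 2 :: real))\<^sup>2 \<le> 2\<^sup>2" using e_less_272 by (simp add: exp_double[symmetric])
    qed simp
    have "exp (t\<^sup>2 * real n / 4) \<le> exp (real k * (1 / 2))" using k by (simp add: mult.commute)
    also have "\<dots> = exp (1 / 2) ^ k" by (rule exp_of_nat_mult)
    also have "\<dots> \<le> 2 ^ k" by (intro power_mono half) simp
    finally have "exp (t\<^sup>2 * real n / 4) \<le> 2 ^ k" .
    moreover have "0 < exp (t\<^sup>2 * real n / 4)" by simp
    ultimately show ?thesis by (subst exp_le_cancel_iff) linarith
  qed
  finally show ?thesis .
qed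

text \<open>For a fixed accuracy a suitable fixed \<open>t\<close> makes the tail bounds summable
  over \<open>n\<close>; Borel-Cantelli and a countable family of accuracies give
  convergence.\<close>

lemma concentration_AE:
  assumes z: "z \<in> dtree d"
    and conc: "\<And>n t. 1 \<le> n \<Longrightarrow> 0 \<le> t \<Longrightarrow>
      prob {\<omega> \<in> space M. \<bar>val n z \<omega> / real n - v\<bar> \<ge> t + 2 * t\<^sup>2 + K / sqrt (real n)}
        \<le> exp (- (1/6) * exp (t\<^sup>2 * real n / 4))"
  shows "AE \<omega> in M. (\<lambda>n. val n z \<omega> / real n) \<longlonglongrightarrow> v"
proof -
  note [measurable] = z
  have "AE \<omega> in M. \<forall>\<^sub>F n in sequentially. \<bar>val n z \<omega> / real n - v\<bar> < \<epsilon>" if \<epsilon>: "0 < \<epsilon>" for \<epsilon>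
  proof -
    define t where "t = min (1 / 2) (\<epsilon> / 4)"
    have t: "0 < t" "t \<le> 1 / 2" "t \<le> \<epsilon> / 4" using \<epsilon> by (auto simp: t_def)
    have "t * t \<le> 1 / 2 * t" using t by (intro mult_right_mono) auto
    then have t2: "t + 2 * t\<^sup>2 \<le> \<epsilon> / 2" using t unfolding power2_eq_square by linarith
    define A where "A n = {\<omega> \<in> space M. \<bar>val n z \<omega> / real n - v\<bar> \<ge> \<epsilon>}" for n
    \<comment> \<open>The bound \<open>exp x \<ge> 1 + x\<close> weakens the doubly exponential tail
      to a geometric one, with 24 = 6 * 4.\<close>
    define r where "r = exp (- (t\<^sup>2 / 24))"
    have r: "0 < r" "r < 1" using t by (auto simp: r_def)
    have "(\<lambda>n. K / sqrt (real n)) \<longlonglongrightarrow> 0"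
      by (intro tendsto_divide_0[OF tendsto_const] filterlim_at_top_imp_at_infinity
          filterlim_compose[OF sqrt_at_top filterlim_real_sequentially])
    then have "\<forall>\<^sub>F n in sequentially. K / sqrt (real n) < \<epsilon> / 2"
      using \<epsilon> by (intro order_tendstoD(2)[of _ 0]) auto
    with eventually_ge_at_top[of 1]
    have "\<forall>\<^sub>F n in sequentially. norm (prob (A n)) \<le> r ^ n"
    proof eventually_elim
      case (elim n)
      have "prob (A n)
          \<le> prob {\<omega> \<in> space M. \<bar>val n z \<omega> / real n - v\<bar> \<ge> t + 2 * t\<^sup>2 + K / sqrt (real n)}"
      proof -
        have "t + 2 * t\<^sup>2 + K / sqrt (real n) \<le> \<epsilon>" using elim t2 by linarith
        then show ?thesis unfolding A_def by (intro finite_measure_mono) auto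
      qed
      also have "\<dots> \<le> exp (- (1/6) * exp (t\<^sup>2 * real n / 4))"
        using elim t by (intro conc) auto
      also have "\<dots> \<le> exp (real n * (- (t\<^sup>2 / 24)))"
        using exp_ge_add_one_self[of "t\<^sup>2 * real n / 4"] by (subst exp_le_cancel_iff) (simp add: field_simps)
      also have "\<dots> = r ^ n" unfolding r_def by (rule exp_of_nat_mult)
      finally show ?case by simp
    qed
    then have "summable (\<lambda>n. prob (A n))"
      by (rule summable_comparison_test_ev) (use r in \<open>simp add: summable_geometric\<close>)
    then have "AE \<omega> in M. \<forall>\<^sub>F n in sequentially. \<omega> \<in> space M - A n"
      by (intro borel_cantelli_AE1) (auto simp: A_def emeasure_eq_measure)
    then show ?thesis
      by eventually_elim (auto simp: A_def not_le elim: eventually_mono)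
  qed
  then have "AE \<omega> in M. \<forall>j. \<forall>\<^sub>F n in sequentially. \<bar>val n z \<omega> / real n - v\<bar> < 1 / real (Suc j)"
    by (intro AE_all_countable[THEN iffD2] allI) simp
  then show ?thesis
  proof eventually_elim
    case (elim \<omega>)
    show ?case
    proof (rule tendstoI)
      fix e :: real assume "0 < e"
      then obtain j where j: "1 / real (Suc j) < e" by (metis nat_approx_posE)
      show "\<forall>\<^sub>F n in sequentially. dist (val n z \<omega> / real n) v < e"
        using elim[rule_format, of j] by eventually_elim (use j in \<open>simp add: dist_real_def\<close>)
    qed
  qed
qed

end

section \<open>Reduction to clamped payoffs and conclusion\<close>

theorem theorem2:
  fixes d :: nat
    and M :: "'w measure"
    and G :: "nat list \<Rightarrow> 'w \<Rightarrow> real"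
    and \<mu> :: "real measure"
  assumes d: "d \<ge> 2"
    and M: "prob_space M"
    and indep: "prob_space.indep_vars M (\<lambda>_. borel) G (dtree d)"
    and ident: "\<And>z. z \<in> dtree d \<Longrightarrow> distr M borel (G z) = \<mu>"
    and supp: "AE x in \<mu>. x \<in> {0..1}"
  shows "\<exists>v\<in>{0..1}.
      (\<forall>\<delta>\<in>{0<..<1/2}. \<exists>K>0. \<forall>z0\<in>dtree d. \<forall>n\<ge>1. \<forall>t\<ge>0.
        measure M {\<omega> \<in> space M.
            \<bar>game_value d (\<lambda>z. G z \<omega>) z0 n - v\<bar> \<ge> t + 2 * t\<^sup>2 + K * real n powr (-\<delta>)}
          \<le> exp (- (1/6) * exp (t\<^sup>2 * real n / 4))) \<and>
      (\<forall>z0\<in>dtree d. AE \<omega> in M. (\<lambda>n. game_value d (\<lambda>z. G z \<omega>) z0 n) \<longlonglongrightarrow> v)"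
proof -
  interpret prob_space M by (rule M)
  \<comment> \<open>Payoffs lie in [0,1] only almost surely. Clamping makes this hold everywhere,
    keeps them i.i.d., and changes none of them outside a null set because the tree is
    countable.\<close>
  define clamp :: "real \<Rightarrow> real" where "clamp x = max 0 (min 1 x)" for x
  have [measurable]: "clamp \<in> borel_measurable borel"
    unfolding clamp_def[abs_def] by measurable
  have G: "G z \<in> borel_measurable M" if "z \<in> dtree d" for z
    using indep that by (auto simp: indep_vars_def)
  interpret C: iid_tree_payoffs M d "\<lambda>z \<omega>. clamp (G z \<omega>)" "distr \<mu> borel clamp"
  proof unfold_locales
    show "indep_vars (\<lambda>_. borel) (\<lambda>z \<omega>. clamp (G z \<omega>)) (dtree d)"
      by (rule indep_vars_compose2[OF indep]) simp
    show "distr M borel (\<lambda>\<omega>. clamp (G z \<omega>)) = distr \<mu> borel clamp" if "z \<in> dtree d" for z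
      unfolding ident[OF that, symmetric] using G[OF that] by (subst distr_distr) (auto simp: comp_def)
  qed (use d in \<open>auto simp: clamp_def\<close>)
  have "countable (dtree d)" by (rule countableI_type)
  moreover have "AE \<omega> in M. clamp (G z \<omega>) = G z \<omega>" if "z \<in> dtree d" for z
  proof -
    have "AE \<omega> in M. G z \<omega> \<in> {0..1}"
      using supp unfolding ident[OF that, symmetric] by (rule AE_distrD[OF G[OF that]])
    then show ?thesis by eventually_elim (auto simp: clamp_def)
  qed
  ultimately have clamp: "AE \<omega> in M. \<forall>z\<in>dtree d. clamp (G z \<omega>) = G z \<omega>"
    by (rule AE_ball_countable[THEN iffD2, rule_format])
  have gv: "AE \<omega> in M. \<forall>n. game_value d (\<lambda>z. G z \<omega>) z0 n = C.val n z0 \<omega> / real n"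
    if z0: "z0 \<in> dtree d" for z0
    using clamp
  proof eventually_elim
    case (elim \<omega>)
    show ?case
    proof
      fix n
      have "tree_value d (\<lambda>z. G z \<omega>) (\<lambda>_. 0) True n z0 = C.val n z0 \<omega>"
        unfolding C.val_def by (rule tree_value_cong) (use elim subtree_dtree[OF z0] in auto)
      then show "game_value d (\<lambda>z. G z \<omega>) z0 n = C.val n z0 \<omega> / real n"
        using game_value_eq_tree_value[OF C.d1 z0] by simp
    qed
  qed
  obtain v B where v: "0 \<le> v" "v \<le> 1" and B: "0 \<le> B" "\<And>n. \<bar>C.mean n - v * real n\<bar> \<le> B * sqrt (real n)"
    using C.mean_approx_linear by blast
  \<comment> \<open>One constant serves every \<open>\<delta>\<close>, because
    \<open>n powr (-1/2) \<le> n powr (-\<delta>)\<close> for \<open>n \<ge> 1\<close>.\<close>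
  define K where "K = B + 2 * real d + 3"
  have K: "0 < K" using B by (simp add: K_def add_nonneg_pos)
  have conc: "measure M {\<omega> \<in> space M. \<bar>C.val n z0 \<omega> / real n - v\<bar> \<ge> t + 2 * t\<^sup>2 + K / sqrt (real n)}
      \<le> exp (- (1/6) * exp (t\<^sup>2 * real n / 4))"
    if "z0 \<in> dtree d" "1 \<le> n" "0 \<le> t" for z0 n t
    by (rule C.concentration[OF v B that]) (simp add: K_def)
  have game_value_tail: "measure M {\<omega> \<in> space M.
      \<bar>game_value d (\<lambda>z. G z \<omega>) z0 n - v\<bar> \<ge> t + 2 * t\<^sup>2 + K * real n powr (-\<delta>)}
      \<le> exp (- (1/6) * exp (t\<^sup>2 * real n / 4))"
    if \<delta>: "\<delta> \<in> {0<..<1/2}" and z0: "z0 \<in> dtree d" and n: "1 \<le> n" and t: "0 \<le> t" for \<delta> z0 n t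
  proof -
    have "real n powr (- (1/2)) \<le> real n powr (-\<delta>)" using n \<delta> by (intro powr_mono) auto
    moreover have "real n powr (- (1/2)) = 1 / sqrt (real n)"
      unfolding powr_minus_divide using powr_half_sqrt[of "real n"] by simp
    ultimately have "K * (1 / sqrt (real n)) \<le> K * real n powr (-\<delta>)"
      using K by (intro mult_left_mono) auto
    then have le: "K / sqrt (real n) \<le> K * real n powr (-\<delta>)" by simp
    have "measure M {\<omega> \<in> space M.
        \<bar>game_value d (\<lambda>z. G z \<omega>) z0 n - v\<bar> \<ge> t + 2 * t\<^sup>2 + K * real n powr (-\<delta>)}
      \<le> measure M {\<omega> \<in> space M. \<bar>C.val n z0 \<omega> / real n - v\<bar> \<ge> t + 2 * t\<^sup>2 + K / sqrt (real n)}"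
    \<comment> \<open>The original and the clamped values agree only almost surely, so the inclusion
      of the events is also only almost sure.\<close>
    proof (rule finite_measure_mono_AE)
      show "AE \<omega> in M. \<omega> \<in> {\<omega> \<in> space M.
          \<bar>game_value d (\<lambda>z. G z \<omega>) z0 n - v\<bar> \<ge> t + 2 * t\<^sup>2 + K * real n powr (-\<delta>)} \<longrightarrow>
        \<omega> \<in> {\<omega> \<in> space M. \<bar>C.val n z0 \<omega> / real n - v\<bar> \<ge> t + 2 * t\<^sup>2 + K / sqrt (real n)}"
        using gv[OF z0]
      proof eventually_elim
        case (elim \<omega>)
        show ?case unfolding mem_Collect_eq elim[rule_format, of n] using le by linarith
      qed
      show "{\<omega> \<in> space M. \<bar>C.val n z0 \<omega> / real n - v\<bar> \<ge> t + 2 * t\<^sup>2 + K / sqrt (real n)} \<in> events"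
        using C.val_measurable[OF z0, of n] by measurable
    qed
    also have "\<dots> \<le> exp (- (1/6) * exp (t\<^sup>2 * real n / 4))"
      by (rule conc[OF z0 n t])
    finally show ?thesis .
  qed
  have tail: "\<forall>\<delta>\<in>{0<..<1/2}. \<exists>K>0. \<forall>z0\<in>dtree d. \<forall>n\<ge>1. \<forall>t\<ge>0.
      measure M {\<omega> \<in> space M.
          \<bar>game_value d (\<lambda>z. G z \<omega>) z0 n - v\<bar> \<ge> t + 2 * t\<^sup>2 + K * real n powr (-\<delta>)}
        \<le> exp (- (1/6) * exp (t\<^sup>2 * real n / 4))"
    by (intro ballI exI[of _ K] conjI allI impI K game_value_tail)
  have lim: "AE \<omega> in M. (\<lambda>n. game_value d (\<lambda>z. G z \<omega>) z0 n) \<longlonglongrightarrow> v" if z0: "z0 \<in> dtree d" for z0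
  proof -
    have "AE \<omega> in M. (\<lambda>n. C.val n z0 \<omega> / real n) \<longlonglongrightarrow> v"
      by (rule C.concentration_AE[OF z0]) (rule conc[OF z0])
    with gv[OF z0] show ?thesis by eventually_elim simp
  qed
  show ?thesis
  proof (intro bexI conjI)
    show "\<forall>z0\<in>dtree d. AE \<omega> in M. (\<lambda>n. game_value d (\<lambda>z. G z \<omega>) z0 n) \<longlonglongrightarrow> v"
      by (intro ballI lim)
    show "v \<in> {0..1}" using v by simp
  qed (rule tail)
qed

end
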